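(* There exists a Toeplitz $\mathbb{Z}$-dynamical system which is not injective.
   Context: A $\mathbb{Z}$-system $(X,T)$ is a compact space $X$ with a homeomorphism $T$. A Toeplitz system is a minimal metrizable $\mathbb{Z}$-system $(X,T)$ which is an almost 1-1 extension of an adding machine: there is a continuous surjection $\pi:X\to G=\varprojlim \mathbb{Z}/p_i\mathbb{Z}$ (with $p_i\mid p_{i+1}$, $p_i\to\infty$) with $\pi(Tx)=\pi(x)+\mathbf{1}$, such that some fiber $\pi^{-1}(g)$ is a singleton. The enveloping semigroup $E(X)$ of $(X,T)$ is the pointwise closure of $\{T^n:n\in\mathbb{Z}\}$ in $X^X$. $P(X)$ is the space of Borel probability measures on $X$ with the weak$^*$ topology and the induced homeomorphism; $X$ embeds in $P(X)$ via $x\mapsto\delta_x$. $X$ is injective if the restriction homomorphism $E(P(X))\to E(X)$ is injective (equivalently, an isomorphism). *)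

theory Defs
  imports "HOL-Probability.Probability"
begin

section \<open>Systems over the integers\<close>

text \<open>A system is given by a topology \<open>X\<close> on some type together with a map \<open>T\<close> on that type; only the
  values of \<open>T\<close> on \<open>topspace X\<close> matter. A compact metrizable space has at most continuum many
  points, so up to homeomorphism the topologies on a type of that cardinality, such as
  \<open>int \<Rightarrow> real\<close>, include all of them.\<close>

definition Z_system :: "'a topology \<Rightarrow> ('a \<Rightarrow> 'a) \<Rightarrow> bool" where
  "Z_system X T \<longleftrightarrow> compact_space X \<and> homeomorphic_map X X T"

definition int_iterate :: "'a topology \<Rightarrow> ('a \<Rightarrow> 'a) \<Rightarrow> int \<Rightarrow> 'a \<Rightarrow> 'a" where
  "int_iterate X T n =
     (if 0 \<le> n then T ^^ nat n else inv_into (topspace X) T ^^ nat (- n))"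

definition minimal_system :: "'a topology \<Rightarrow> ('a \<Rightarrow> 'a) \<Rightarrow> bool" where
  "minimal_system X T \<longleftrightarrow> Z_system X T \<and> topspace X \<noteq> {} \<and>
     (\<forall>A. closedin X A \<and> T ` A = A \<longrightarrow> A = {} \<or> A = topspace X)"


section \<open>Adding machines and Toeplitz systems\<close>

text \<open>The group \<open>\<int>/m\<close> is represented by the residues \<open>{0..<m}\<close>, and the inverse limit as the set of
  coherent sequences of residues, with the topology induced from the product of discrete spaces.\<close>

definition adding_machine_base :: "(nat \<Rightarrow> nat) \<Rightarrow> bool" where
  "adding_machine_base p \<longleftrightarrow>
     (\<forall>i. 0 < p i) \<and> (\<forall>i. p i dvd p (Suc i)) \<and> filterlim p at_top sequentially"

definition adding_machine :: "(nat \<Rightarrow> nat) \<Rightarrow> (nat \<Rightarrow> nat) topology" where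
  "adding_machine p =
     subtopology (product_topology (\<lambda>i. discrete_topology {0..<p i}) UNIV)
       {g. \<forall>i. g (Suc i) mod p i = g i}"

definition add_one :: "(nat \<Rightarrow> nat) \<Rightarrow> (nat \<Rightarrow> nat) \<Rightarrow> nat \<Rightarrow> nat" where
  "add_one p g = (\<lambda>i. (g i + 1) mod p i)"

definition almost_one_to_one_extension ::
    "'a topology \<Rightarrow> ('a \<Rightarrow> 'a) \<Rightarrow> 'b topology \<Rightarrow> ('b \<Rightarrow> 'b) \<Rightarrow> bool" where
  "almost_one_to_one_extension X T Y S \<longleftrightarrow>
     (\<exists>\<pi>. continuous_map X Y \<pi> \<and> \<pi> ` topspace X = topspace Y \<and>
        (\<forall>x\<in>topspace X. \<pi> (T x) = S (\<pi> x)) \<and>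
        (\<exists>g\<in>topspace Y. is_singleton {x \<in> topspace X. \<pi> x = g}))"

definition toeplitz_system :: "'a topology \<Rightarrow> ('a \<Rightarrow> 'a) \<Rightarrow> bool" where
  "toeplitz_system X T \<longleftrightarrow> minimal_system X T \<and> metrizable_space X \<and>
     (\<exists>p. adding_machine_base p \<and>
        almost_one_to_one_extension X T (adding_machine p) (add_one p))"


section \<open>Enveloping semigroups\<close>

text \<open>Elements of \<open>topspace X \<rightarrow> topspace X\<close> are extensional functions, so that equality of elements
  of the enveloping semigroup is equality on \<open>topspace X\<close>.\<close>

definition enveloping_semigroup :: "'a topology \<Rightarrow> ('a \<Rightarrow> 'a) \<Rightarrow> ('a \<Rightarrow> 'a) set" where
  "enveloping_semigroup X T =
     product_topology (\<lambda>_. X) (topspace X) closure_of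
       range (\<lambda>n. restrict (int_iterate X T n) (topspace X))"


section \<open>The space of probability measures and injectivity\<close>

definition borel_of :: "'a topology \<Rightarrow> 'a measure" where
  "borel_of X = sigma (topspace X) {U. openin X U}"

definition borel_probabilities :: "'a topology \<Rightarrow> 'a measure set" where
  "borel_probabilities X = {M. prob_space M \<and> sets M = sets (borel_of X)}"

text \<open>The weak* topology: the coarsest topology making \<open>M \<mapsto> \<integral> f dM\<close> continuous for every continuous
  real function \<open>f\<close> on \<open>X\<close>. As \<open>X\<close> is compact, every such \<open>f\<close> is bounded, hence integrable.\<close>

definition prob_topology :: "'a topology \<Rightarrow> 'a measure topology" where
  "prob_topology X =
     pullback_topology (borel_probabilities X)
       (\<lambda>M. \<lambda>f\<in>{f. continuous_map X euclideanreal f}. LINT x|M. f x)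
       (product_topology (\<lambda>_. euclideanreal) {f. continuous_map X euclideanreal f})"

definition prob_map :: "'a topology \<Rightarrow> ('a \<Rightarrow> 'a) \<Rightarrow> 'a measure \<Rightarrow> 'a measure" where
  "prob_map X T M = distr M (borel_of X) T"

definition dirac :: "'a topology \<Rightarrow> 'a \<Rightarrow> 'a measure" where
  "dirac X x = return (borel_of X) x"

text \<open>For \<open>X\<close> compact Hausdorff, \<open>dirac X\<close> is injective on \<open>topspace X\<close> with closed invariant image, so
  every element \<open>P\<close> of the enveloping semigroup of the space of measures preserves this image; its
  restriction is the self-map \<open>q\<close> of \<open>topspace X\<close> with \<open>P (dirac X x) = dirac X (q x)\<close>.\<close>

definition enveloping_restriction ::
    "'a topology \<Rightarrow> ('a measure \<Rightarrow> 'a measure) \<Rightarrow> 'a \<Rightarrow> 'a" where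
  "enveloping_restriction X P =
     (\<lambda>x\<in>topspace X. inv_into (topspace X) (dirac X) (P (dirac X x)))"

definition injective_system :: "'a topology \<Rightarrow> ('a \<Rightarrow> 'a) \<Rightarrow> bool" where
  "injective_system X T \<longleftrightarrow>
     inj_on (enveloping_restriction X)
       (enveloping_semigroup (prob_topology X) (prob_map X T))"


lemma topspace_prob_topology: "topspace (prob_topology X) = borel_probabilities X"
  by (auto simp: prob_topology_def topspace_pullback_topology)

end

theory Submission
  imports Defs
begin

text \<open>
  The idea. By dominated convergence, a sequence of powers of \<open>T\<close> that converges pointwise on \<open>X\<close>
  also converges on the measures, and its limit on the measures is the push-forward by its limit
  on \<open>X\<close>. A net need not behave like this. So the aim is a Toeplitz system with a fibre
  \<open>{\<Phi> \<kappa> | \<kappa> \<in> [0,1]}\<close> over the adding machine and with times \<open>hole i\<close> at which the point \<open>\<Phi> \<kappa>\<close>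
  shows the symbol \<open>phi i \<kappa>\<close>, where \<open>phi\<close> lists a countable family of continuous functions on
  \<open>[0,1]\<close>, each one infinitely often. The family contains the constant 1, and it contains bumps
  that are close to 1 on any given finite set and vanish off a small neighbourhood of it. Along a
  sequence of times with \<open>phi i = 1\<close>, and also along a suitable net of times with ever finer bumps,
  the powers of \<open>T\<close> converge pointwise on \<open>X\<close> to one and the same map, since each single \<open>\<kappa>\<close> is
  eventually near the top of the bumps. But if \<open>\<mu>\<close> is the image of Lebesgue measure under \<open>\<Phi>\<close>, then
  the first limit of \<open>\<mu>\<close> gives the symbol 1 full mass and the second gives it mass 0.

  The system. In the adding machine with \<open>per (k + 1) = (k + 5) * per k\<close> let \<open>\<zeta> = \<Sum>l. per l\<close>, which
  is the limit of the integers \<open>hole i = \<Sum>l<i. per l\<close>. The symbol function (\<open>semicocycle\<close>) is locally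
  constant away from the points \<open>hole i\<close> and \<open>\<zeta>\<close>. Near \<open>hole i\<close> it is
  \<open>phi i (angle (z - hole i))\<close>, where \<open>angle\<close> of a nonzero element is its first nonzero digit divided
  by the base of that digit: this oscillates through \<open>[0,1]\<close> near 0. The orbit of \<open>-\<zeta>\<close> misses all
  discontinuities, hence it gives a Toeplitz sequence: the symbol at time \<open>n\<close> is the one at the
  position \<open>n - \<zeta>\<close>. The system is the orbit closure of this sequence, with the residues of the time
  recorded as well. A point of the closure whose position is 0 has the symbols
  \<open>phi i \<kappa>\<close> at all the holes at once, with one and the same \<open>\<kappa>\<close>, because all holes see the same
  approach to 0.

  Why nothing else interferes. For every point \<open>x\<close> and position \<open>j\<close>, either \<open>x\<close> is the point of
  parameter \<open>\<kappa>\<close> in the fibre that has the holes at \<open>hole i + j\<close>, or the symbol of \<open>x\<close> at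
  \<open>hole i + j\<close> converges as \<open>i\<close> grows (\<open>hole_dichotomy\<close>). So the limit of the powers \<open>hole i\<close> along
  any sequence depends on the choice of the \<open>phi i\<close> only through the values \<open>phi i \<kappa>\<close>
  (\<open>tendsto_limit_pt\<close>).

  The two elements. Both are explicit maps on the space of measures. \<open>env_one\<close> pushes every
  measure forward by the limit along \<open>phi i = 1\<close>. \<open>env_atom\<close> pushes \<open>\<mu>\<close> forward by the map that agrees with this limit at the atoms of
  \<open>\<mu>\<close> and with the limit along \<open>phi i = 0\<close> elsewhere. For finitely many measures, one sequence of
  bumps converges to 1 at the countably many parameters of atoms and to 0 at almost every other
  parameter (\<open>separating_bumps\<close>), so \<open>env_atom\<close> is the limit of a net of powers of the transformation. On
  Dirac measures the two agree, since there the only point that counts is an atom.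
\<close>

section \<open>The adding machine and the limit of the holes\<close>

text \<open>The bases \<open>k + 5\<close> tend to infinity, so that digits divided by their base become dense in \<open>[0,1]\<close>. They are
  at least 5 to keep \<open>\<zeta>\<close> and \<open>2 * \<zeta>\<close> away from the integers.\<close>
primrec per :: "nat \<Rightarrow> nat" where
  "per 0 = 1"
| "per (Suc k) = (k + 5) * per k"

definition hole :: "nat \<Rightarrow> int" where
  "hole i = (\<Sum>l<i. int (per l))"

lemma per_pos [simp]: "0 < per k"
  by (induction k) auto

declare per.simps(2) [simp del]
lemmas per_Suc = per.simps(2)

lemma per_dvd: "k \<le> l \<Longrightarrow> per k dvd per l"
  by (induction l rule: dec_induct) (auto simp: per_Suc)

lemma per_dvd_trans: "k \<le> l \<Longrightarrow> int (per l) dvd a \<Longrightarrow> int (per k) dvd a"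
  using per_dvd[of k l] by (meson dvd_trans of_nat_dvd_iff)

lemma hole_0 [simp]: "hole 0 = 0" and hole_Suc: "hole (Suc i) = hole i + int (per i)"
  by (simp_all add: hole_def)

lemma hole_cong: "k \<le> i \<Longrightarrow> int (per k) dvd hole i - hole k"
proof (induction i rule: dec_induct)
  case (step n)
  have "int (per k) dvd (hole n - hole k) + int (per n)"
    using step per_dvd[of k n] by (intro dvd_add) auto
  then show ?case by (simp add: hole_Suc algebra_simps)
qed simp

lemma four_hole_le: "4 * hole k \<le> int (per k)"
proof (induction k)
  case (Suc k)
  have "int (per (Suc k)) = int k * int (per k) + 5 * int (per k)" by (simp add: per_Suc algebra_simps)
  moreover have "0 \<le> int k * int (per k)" by simp
  moreover have "4 * (hole k + int (per k)) = 4 * hole k + 4 * int (per k)" by simp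
  moreover have "0 \<le> int (per k)" by simp
  ultimately show ?case using Suc unfolding hole_Suc by linarith
qed simp

lemma le_hole: "int k \<le> hole k"
proof (induction k)
  case (Suc k)
  then show ?case using per_pos[of k] by (simp add: hole_Suc del: per_pos)
qed simp

lemma strict_mono_hole: "strict_mono hole"
  by (rule strict_mono_Suc_iff[THEN iffD2]) (simp add: hole_Suc)

lemma inj_hole: "inj hole"
  using strict_mono_hole strict_mono_imp_inj_on by blast

lemma hole_nonneg: "0 \<le> hole k"
  using le_hole[of k] by linarith

text \<open>An integer \<open>n\<close> equal to \<open>c * \<zeta>\<close> would be congruent to \<open>c * hole k\<close> modulo \<open>per k\<close> for all \<open>k\<close>. But
  \<open>hole k\<close> tends to infinity while staying below \<open>per k / 4\<close>, so for large \<open>k\<close> the two numbers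
  are distinct and differ by less than the modulus. The cases \<open>c = 1\<close> and \<open>c = 2\<close> say that the orbit of \<open>- \<zeta>\<close> avoids
  the points \<open>hole i\<close> and \<open>\<zeta>\<close>.\<close>
lemma multiple_of_zeta_not_integer:
  fixes n c :: int
  assumes "c = 1 \<or> c = 2"
  shows "\<exists>k. \<not> int (per k) dvd n - c * hole k"
proof
  define k where "k = nat \<bar>n\<bar> + 1"
  have k: "\<bar>n\<bar> < hole k" using le_hole[of k] by (simp add: k_def)
  show "\<not> int (per k) dvd n - c * hole k"
  proof
    assume d: "int (per k) dvd n - c * hole k"
    have "0 < c * hole k - n" "c * hole k - n < int (per k)"
      using k assms four_hole_le[of k] by auto
    moreover have "int (per k) dvd c * hole k - n"
      using d by (subst dvd_minus_iff[symmetric]) simp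
    ultimately show False using zdvd_not_zless by blast
  qed
qed

text \<open>Elements of the inverse limit are handled as sequences of integers whose \<open>k\<close>-th term matters only
  modulo \<open>per k\<close>. Constant sequences are the integers, and \<open>hole\<close> itself represents \<open>\<zeta>\<close>.\<close>
definition coherent :: "(nat \<Rightarrow> int) \<Rightarrow> bool" where
  "coherent z \<longleftrightarrow> (\<forall>k. int (per k) dvd z (Suc k) - z k)"

lemma coherent_dvd_diff:
  assumes "coherent z" "k \<le> l" shows "int (per k) dvd z l - z k"
  using assms(2)
proof (induction l rule: dec_induct)
  case (step n)
  have "int (per k) dvd (z (Suc n) - z n) + (z n - z k)"
    using step assms(1) by (intro dvd_add) (auto simp: coherent_def intro: per_dvd_trans[of k n])
  then show ?case by simp
qed simp

lemma coherent_const [simp]: "coherent (\<lambda>k. n)"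
  by (simp add: coherent_def)

lemma coherent_hole [simp]: "coherent hole"
  by (simp add: coherent_def hole_Suc)

lemma coherent_add [simp]:
  assumes "coherent y" "coherent z" shows "coherent (\<lambda>k. y k + z k)"
  unfolding coherent_def
proof
  fix k
  have "int (per k) dvd (y (Suc k) - y k) + (z (Suc k) - z k)"
    using assms by (intro dvd_add) (auto simp: coherent_def)
  then show "int (per k) dvd y (Suc k) + z (Suc k) - (y k + z k)" by (simp add: algebra_simps)
qed

lemma coherent_diff [simp]:
  assumes "coherent y" "coherent z" shows "coherent (\<lambda>k. y k - z k)"
  unfolding coherent_def
proof
  fix k
  have "int (per k) dvd (y (Suc k) - y k) - (z (Suc k) - z k)"
    using assms by (blast intro: dvd_diff dest: coherent_def[THEN iffD1])
  then show "int (per k) dvd y (Suc k) - z (Suc k) - (y k - z k)" by (simp add: algebra_simps)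
qed

definition nonzero :: "(nat \<Rightarrow> int) \<Rightarrow> bool" where
  "nonzero z \<longleftrightarrow> (\<exists>k. \<not> int (per k) dvd z k)"

definition near :: "nat \<Rightarrow> (nat \<Rightarrow> int) \<Rightarrow> (nat \<Rightarrow> int) \<Rightarrow> bool" where
  "near l y z \<longleftrightarrow> int (per l) dvd z l - y l"

lemma near_mono:
  assumes "near l y z" "k \<le> l" "coherent y" "coherent z"
  shows "near k y z"
proof -
  have "int (per k) dvd (z l - y l) - (z l - z k) + (y l - y k)"
    using assms per_dvd_trans[of k l "z l - y l"] coherent_dvd_diff[of _ k l]
    by (intro dvd_add[OF dvd_diff]) (auto simp: near_def)
  then show ?thesis by (simp add: near_def)
qed

text \<open>The position of the first nonzero digit of a nonzero element: the valuation, for the sequence \<open>per\<close>.\<close>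
definition level :: "(nat \<Rightarrow> int) \<Rightarrow> nat" where
  "level z = (LEAST k. \<not> int (per (Suc k)) dvd z (Suc k))"

text \<open>With \<open>k = level z\<close>, this is the \<open>k\<close>-th digit of \<open>z\<close> divided by its base \<open>per (k + 1) / per k\<close>.\<close>
definition angle :: "(nat \<Rightarrow> int) \<Rightarrow> real" where
  "angle z = real_of_int (z (Suc (level z)) mod int (per (Suc (level z)))) / real (per (Suc (level z)))"

lemma level_eqI:
  assumes "coherent z" "int (per i) dvd z i" "\<not> int (per (Suc i)) dvd z (Suc i)"
  shows "level z = i"
  unfolding level_def
proof (rule Least_equality)
  fix k assume k: "\<not> int (per (Suc k)) dvd z (Suc k)"
  show "i \<le> k"
  proof (rule ccontr)
    assume "\<not> i \<le> k"
    then have "Suc k \<le> i" by simp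
    then have "int (per (Suc k)) dvd z i - (z i - z (Suc k))"
      using per_dvd_trans[OF _ assms(2), of "Suc k"] coherent_dvd_diff[OF assms(1), of "Suc k" i]
      using \<open>Suc k \<le> i\<close> by (blast intro: dvd_diff)
    with k show False by (simp)
  qed
qed (use assms in auto)

lemma level_nonzero:
  assumes "nonzero z"
  shows "\<not> int (per (Suc (level z))) dvd z (Suc (level z))" "int (per (level z)) dvd z (level z)"
proof -
  obtain k where k: "\<not> int (per k) dvd z k" using assms by (auto simp: nonzero_def)
  then obtain k' where "k = Suc k'" by (cases k) auto
  then have "\<exists>k. \<not> int (per (Suc k)) dvd z (Suc k)" using k by blast
  then show "\<not> int (per (Suc (level z))) dvd z (Suc (level z))"
    unfolding level_def by (rule LeastI_ex)
  show "int (per (level z)) dvd z (level z)"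
  proof (cases "level z")
    case (Suc k')
    then show ?thesis using not_less_Least[of k' "\<lambda>k. \<not> int (per (Suc k)) dvd z (Suc k)"]
      by (auto simp: level_def)
  qed simp
qed

lemma near_level:
  assumes "coherent y" "coherent z" "nonzero y" "near (Suc (level y)) y z"
  shows "level z = level y" "angle z = angle y"
proof -
  let ?i = "level y"
  have m: "z (Suc ?i) mod int (per (Suc ?i)) = y (Suc ?i) mod int (per (Suc ?i))"
    using assms(4) by (simp only: near_def mod_eq_dvd_iff)
  then have nd: "\<not> int (per (Suc ?i)) dvd z (Suc ?i)"
    using level_nonzero(1)[OF assms(3)] by (simp add: dvd_eq_mod_eq_0)
  have "near ?i y z" using near_mono[OF assms(4) _ assms(1,2)] by simp
  then have "int (per ?i) dvd z ?i"
    using level_nonzero(2)[OF assms(3)] unfolding near_def by (simp add: dvd_diff_left_iff)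
  with nd show l: "level z = level y" by (intro level_eqI assms) auto
  show "angle z = angle y" unfolding angle_def l m ..
qed

lemma angle_bounds: "0 \<le> angle z" "angle z \<le> 1"
proof -
  let ?q = "per (Suc (level z))"
  have "0 \<le> z (Suc (level z)) mod int ?q" "z (Suc (level z)) mod int ?q < int ?q"
    by (simp_all)
  then have "0 \<le> real_of_int (z (Suc (level z)) mod int ?q)"
    "real_of_int (z (Suc (level z)) mod int ?q) \<le> real ?q" by linarith+
  then show "0 \<le> angle z" "angle z \<le> 1"
    unfolding angle_def by (auto)
qed

section \<open>A countable family of bump functions\<close>

text \<open>Rational centres and integer slopes make the family countable. The degenerate members are useful as
  well: no centres or slope 0 give the constant 1, the centre 2 gives 0 on \<open>[0,1]\<close>, and the centre 1
  gives the identity on \<open>[0,1]\<close>.\<close>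
definition bump :: "rat list \<times> nat \<Rightarrow> real \<Rightarrow> real" where
  "bump c t = max 0 (1 - real (snd c) * infdist t (real_of_rat ` set (fst c)))"

text \<open>Reading only the first component of the pair coded by \<open>i\<close> makes each bump occur infinitely often.\<close>
definition phi :: "nat \<Rightarrow> real \<Rightarrow> real" where
  "phi i = bump (from_nat (fst (prod_decode i)))"

lemma continuous_bump: "continuous_on A (bump c)"
  unfolding bump_def by (intro continuous_intros)

lemma bump_bounds: "0 \<le> bump c t" "bump c t \<le> 1"
  by (auto simp: bump_def infdist_nonneg)

lemma phi_bounds: "0 \<le> phi i t" "phi i t \<le> 1"
  by (simp_all add: phi_def bump_bounds)

lemma continuous_phi: "continuous_on A (phi i)"
  by (simp add: phi_def continuous_bump)

lemma isCont_phi: "isCont (phi i) t"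
  using continuous_phi[of UNIV i] by (simp add: continuous_on_eq_continuous_at)

lemma phi_code: "phi (prod_encode (to_nat c, n)) = bump c"
  by (simp add: phi_def)

definition id_ix :: nat where "id_ix = prod_encode (to_nat ([1::rat], 1::nat), 0)"
definition one_ix :: "nat \<Rightarrow> nat" where "one_ix n = prod_encode (to_nat ([]::rat list, 0::nat), n)"
definition zero_ix :: "nat \<Rightarrow> nat" where "zero_ix n = prod_encode (to_nat ([2::rat], 1::nat), n)"

lemma phi_id_ix: "0 \<le> t \<Longrightarrow> t \<le> 1 \<Longrightarrow> phi id_ix t = t"
  by (simp add: id_ix_def phi_code bump_def infdist_singleton dist_real_def)

lemma phi_one_ix: "phi (one_ix n) t = 1"
  by (simp add: one_ix_def phi_code bump_def)

lemma phi_zero_ix: "t \<le> 1 \<Longrightarrow> phi (zero_ix n) t = 0"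
  by (simp add: zero_ix_def phi_code bump_def dist_real_def)

lemma filterlim_one_ix: "filterlim one_ix at_top sequentially"
  and filterlim_zero_ix: "filterlim zero_ix at_top sequentially"
  unfolding one_ix_def zero_ix_def by (rule filterlim_at_top_mono[OF filterlim_ident], simp add: le_prod_encode_2)+

section \<open>The Toeplitz sequence\<close>

text \<open>If \<open>z\<close> agrees with \<open>\<zeta>\<close> in exactly the first \<open>i\<close> digits, then \<open>hole i\<close> is the only hole that can agree with
  \<open>z\<close> in one digit more. This makes the discs on which the symbol is prescribed by the holes disjoint, and
  none of them contains \<open>\<zeta>\<close>.\<close>
definition semicocycle :: "(nat \<Rightarrow> int) \<Rightarrow> real" where
  "semicocycle z = (let i = level (\<lambda>k. z k - hole k) in
     if int (per (Suc i)) dvd z (Suc i) - hole i then phi i (angle (\<lambda>k. z k - hole i)) else 0)"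

lemma semicocycle_bounds: "0 \<le> semicocycle z" "semicocycle z \<le> 1"
  by (simp_all add: semicocycle_def Let_def phi_bounds)

lemma not_per_Suc_dvd: "\<not> int (per (Suc i)) dvd - int (per i)" 
proof
  assume "int (per (Suc i)) dvd - int (per i)"
  then have "int (per (Suc i)) \<le> int (per i)" by (intro zdvd_imp_le) auto
  then show False using per_pos[of i] by (simp add: per_Suc del: per_pos)
qed

lemma level_hole_diff:
  "level (\<lambda>k. hole i - hole k) = i" "nonzero (\<lambda>k. hole i - hole k)"
proof -
  have *: "\<not> int (per (Suc i)) dvd hole i - hole (Suc i)"
    using not_per_Suc_dvd[of i] by (simp add: hole_Suc)
  then show "nonzero (\<lambda>k. hole i - hole k)"
    unfolding nonzero_def by blast
  show "level (\<lambda>k. hole i - hole k) = i"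
    by (rule level_eqI[OF coherent_diff[OF coherent_const coherent_hole]]) (use * in simp_all)
qed

text \<open>The first nonzero digit of \<open>hole i - \<zeta>\<close> is the largest one possible, because \<open>\<zeta> - hole i\<close> begins
  with the digit 1. So the holes approach \<open>\<zeta>\<close> in such a way that the angle converges.\<close>
lemma angle_hole_diff: "angle (\<lambda>k. hole i - hole k) = 1 - 1 / (real i + 5)"
proof -
  have lt: "int (per i) < int (per (Suc i))"
    using per_pos[of i] by (simp add: per_Suc del: per_pos)
  have "(- int (per i)) mod int (per (Suc i)) = (int (per (Suc i)) - int (per i)) mod int (per (Suc i))"
    by (simp add: mod_eq_dvd_iff)
  also have "\<dots> = int (per (Suc i)) - int (per i)"
    using lt by (intro mod_pos_pos_trivial) simp_all
  finally have "(- int (per i)) mod int (per (Suc i)) = int (per (Suc i)) - int (per i)" .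
  then have "angle (\<lambda>k. hole i - hole k) = (real (per (Suc i)) - real (per i)) / real (per (Suc i))"
    unfolding angle_def level_hole_diff by (simp add: hole_Suc)
  also have "\<dots> = 1 - 1 / (real i + 5)"
    by (simp add: per_Suc diff_divide_distrib add.commute)
  finally show ?thesis .
qed

lemma semicocycle_near_hole:
  assumes "coherent z" "near (Suc i) (\<lambda>k. hole i) z"
  shows "semicocycle z = phi i (angle (\<lambda>k. z k - hole i))"
proof -
  have c1: "coherent (\<lambda>k. hole i - hole k)" by simp
  have c2: "coherent (\<lambda>k. z k - hole k)" using assms by simp
  have "near (Suc i) (\<lambda>k. hole i - hole k) (\<lambda>k. z k - hole k)"
    using assms(2) by (simp add: near_def)
  then have "level (\<lambda>k. z k - hole k) = level (\<lambda>k. hole i - hole k)"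
    using near_level(1)[OF c1 c2] by (simp add: level_hole_diff)
  then show ?thesis using assms(2) by (simp add: semicocycle_def level_hole_diff near_def)
qed

lemma semicocycle_locally_constant:
  assumes z: "coherent z" and zeta: "nonzero (\<lambda>k. z k - hole k)" and h: "\<And>i. nonzero (\<lambda>k. z k - hole i)"
  shows "\<exists>l. \<forall>y. coherent y \<longrightarrow> near l z y \<longrightarrow> semicocycle y = semicocycle z"
proof -
  define i where "i = level (\<lambda>k. z k - hole k)"
  define l where "l = Suc (max i (level (\<lambda>k. z k - hole i)))"
  have "semicocycle y = semicocycle z" if y: "coherent y" "near l z y" for y
  proof -
    have n1: "near (Suc i) z y" and n2: "near (Suc (level (\<lambda>k. z k - hole i))) z y"
      using near_mono[OF y(2) _ z y(1)] by (auto simp: l_def)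
    have "level (\<lambda>k. y k - hole k) = i"
      unfolding i_def by (rule near_level) (use n1 z y zeta in \<open>auto simp: near_def i_def\<close>)
    moreover have "angle (\<lambda>k. y k - hole i) = angle (\<lambda>k. z k - hole i)"
      by (rule near_level) (use n2 z y h in \<open>auto simp: near_def\<close>)
    moreover have "int (per (Suc i)) dvd y (Suc i) - hole i \<longleftrightarrow> int (per (Suc i)) dvd z (Suc i) - hole i"
      using n1 dvd_add_right_iff[of "int (per (Suc i))" "y (Suc i) - z (Suc i)" "z (Suc i) - hole i"]
      by (simp add: near_def)
    ultimately show ?thesis by (simp add: semicocycle_def Let_def i_def[symmetric])
  qed
  then show ?thesis by blast
qed

definition toeplitz_seq :: "int \<Rightarrow> real" where
  "toeplitz_seq n = semicocycle (\<lambda>k. n - hole k)"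

text \<open>The Toeplitz property: every symbol recurs along an arithmetic progression.\<close>
lemma toeplitz_seq_locally_constant: "\<exists>l. \<forall>m. int (per l) dvd m - n \<longrightarrow> toeplitz_seq m = toeplitz_seq n"
proof -
  have "nonzero (\<lambda>k. (n - hole k) - hole k)"
    using multiple_of_zeta_not_integer[of 2 n] by (simp add: nonzero_def algebra_simps)
  moreover have "nonzero (\<lambda>k. (n - hole k) - hole i)" for i
    using multiple_of_zeta_not_integer[of 1 "n - hole i"] by (simp add: nonzero_def algebra_simps)
  ultimately obtain l where l: "\<And>y. coherent y \<Longrightarrow> near l (\<lambda>k. n - hole k) y \<Longrightarrow> semicocycle y = semicocycle (\<lambda>k. n - hole k)"
    using semicocycle_locally_constant[of "\<lambda>k. n - hole k"] by auto
  have "toeplitz_seq m = toeplitz_seq n" if "int (per l) dvd m - n" for m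
    using l[of "\<lambda>k. m - hole k"] that by (simp add: toeplitz_seq_def near_def)
  then show ?thesis by blast
qed

section \<open>The orbit closure\<close>

lemma tendsto_fun_iff:
  fixes f :: "'a \<Rightarrow> 'i \<Rightarrow> 'b::topological_space"
  shows "(f \<longlongrightarrow> l) F \<longleftrightarrow> (\<forall>i. ((\<lambda>t. f t i) \<longlongrightarrow> l i) F)"
proof -
  have "(f \<longlongrightarrow> l) F \<longleftrightarrow> limitin (product_topology (\<lambda>_. euclidean) UNIV) f l F"
    by (simp add: euclidean_product_topology)
  also have "\<dots> \<longleftrightarrow> (\<forall>i. ((\<lambda>t. f t i) \<longlongrightarrow> l i) F)"
    unfolding limitin_componentwise by (auto simp: extensional_def)
  finally show ?thesis .
qed

text \<open>A point carries its symbols at the even coordinates and the residues of its time at the odd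
  coordinates \<open>2 * i + 1\<close> with \<open>i \<ge> 0\<close>. For negative odd \<open>k\<close>, \<open>nat (k div 2) = 0\<close> and \<open>per 0 = 1\<close>, so that
  the coordinate is 0. Recording the residues gives the factor map onto the adding machine for free.\<close>
definition orbit_point :: "int \<Rightarrow> int \<Rightarrow> real" where
  "orbit_point n k = (if even k then toeplitz_seq (n + k div 2)
     else of_int (n mod int (per (nat (k div 2)))))"

text \<open>The \<open>m\<close>-th power of the transformation, for all integers \<open>m\<close> at once: symbols are shifted and residues
  are increased.\<close>
definition act :: "int \<Rightarrow> (int \<Rightarrow> real) \<Rightarrow> int \<Rightarrow> real" where
  "act m x k = (if even k then x (k + 2 * m)
     else of_int ((\<lfloor>x k\<rfloor> + m) mod int (per (nat (k div 2)))))"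

definition cell :: "int \<Rightarrow> real set" where
  "cell k = (if even k then {0..1} else of_int ` {0..<int (per (nat (k div 2)))})"

definition orbit_hull :: "(int \<Rightarrow> real) set" where
  "orbit_hull = closure (range orbit_point)"

lemma compact_PiE_cell: "compact (PiE UNIV cell)"
proof -
  have "compact (cell k)" for k by (auto simp: cell_def intro: finite_imp_compact)
  then have "compactin (product_topology (\<lambda>_. euclidean) UNIV) (PiE UNIV cell)"
    by (simp add: compactin_PiE)
  then show ?thesis by (simp add: euclidean_product_topology)
qed

lemma orbit_point_in_cell: "orbit_point n k \<in> cell k"
  by (auto simp: orbit_point_def cell_def toeplitz_seq_def semicocycle_bounds)

lemma hull_subset: "orbit_hull \<subseteq> PiE UNIV cell"
  unfolding orbit_hull_def using compact_PiE_cell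
  by (intro closure_minimal compact_imp_closed) (auto simp: orbit_point_in_cell)

lemma hull_cell: "x \<in> orbit_hull \<Longrightarrow> x k \<in> cell k"
  using hull_subset by auto

lemma closed_hull: "closed orbit_hull"
  by (simp add: orbit_hull_def)

lemma compact_hull: "compact orbit_hull"
  using compact_PiE_cell hull_subset closed_hull by (metis closed_Int_compact inf.absorb1)

lemma orbit_point_in_hull: "orbit_point n \<in> orbit_hull"
  using closure_subset[of "range orbit_point"] by (auto simp: orbit_hull_def)

lemma act_orbit_point: "act m (orbit_point n) = orbit_point (n + m)"
  by (rule ext) (auto simp: act_def orbit_point_def mod_simps algebra_simps)

lemma act_act: "act m (act n x) = act (m + n) x"
  by (rule ext) (auto simp: act_def mod_simps algebra_simps)

lemma act_0: assumes "x \<in> orbit_hull" shows "act 0 x = x"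
proof
  fix k show "act 0 x k = x k"
    using hull_cell[OF assms, of k] by (auto simp: act_def cell_def)
qed

lemma continuous_act: "continuous_on orbit_hull (act m)"
proof (rule continuous_on_coordinatewise_then_product)
  fix k
  show "continuous_on orbit_hull (\<lambda>x. act m x k)"
  proof (cases "even k")
    case True
    then show ?thesis by (simp add: act_def continuous_on_subset[OF continuous_on_product_coordinates])
  next
    case False
    let ?h = "\<lambda>t::real. real_of_int ((\<lfloor>t\<rfloor> + m) mod int (per (nat (k div 2))))"
    have "finite (cell k)" using False by (simp add: cell_def)
    then have "continuous_on (cell k) ?h" by (rule continuous_on_finite)
    then have "continuous_on orbit_hull (?h \<circ> (\<lambda>x. x k))"
      by (intro continuous_on_compose continuous_on_subset[OF continuous_on_product_coordinates])
        (auto intro: continuous_on_subset simp: hull_cell image_subset_iff)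
    then show ?thesis using False by (simp add: act_def o_def)
  qed
qed

lemma act_in_hull: assumes "x \<in> orbit_hull" shows "act m x \<in> orbit_hull"
proof -
  have "act m ` closure (range orbit_point) \<subseteq> orbit_hull"
    by (rule image_closure_subset) (use continuous_act closed_hull in \<open>auto simp: orbit_hull_def[symmetric] act_orbit_point orbit_point_in_hull\<close>)
  then show ?thesis using assms by (auto simp: orbit_hull_def)
qed

lemma act_inverse: "x \<in> orbit_hull \<Longrightarrow> act (- m) (act m x) = x" "x \<in> orbit_hull \<Longrightarrow> act m (act (- m) x) = x"
  by (simp_all add: act_act act_0)

lemma hull_sequence:
  assumes "x \<in> orbit_hull"
  obtains n :: "nat \<Rightarrow> int" where "(\<lambda>t. orbit_point (n t)) \<longlonglongrightarrow> x"
proof -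
  from assms obtain y where y: "\<And>t. y t \<in> range orbit_point" "y \<longlonglongrightarrow> x"
    unfolding orbit_hull_def closure_sequential by blast
  then have "\<forall>t. \<exists>n. y t = orbit_point n" by auto
  then obtain n where "\<And>t. y t = orbit_point (n t)" by metis
  with y(2) have "(\<lambda>t. orbit_point (n t)) \<longlonglongrightarrow> x" by (simp add: LIMSEQ_def)
  then show ?thesis using that by blast
qed

lemma hull_limit:
  assumes "(\<lambda>t. y t) \<longlonglongrightarrow> x" "\<And>t::nat. y t \<in> orbit_hull" shows "x \<in> orbit_hull"
  using closed_hull assms by (meson closed_sequentially)

lemma tendsto_act:
  assumes "y \<longlonglongrightarrow> x" "\<And>t::nat. y t \<in> orbit_hull" shows "(\<lambda>t. act m (y t)) \<longlonglongrightarrow> act m x"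
  using continuous_act[of m] assms hull_limit[OF assms] unfolding continuous_on_sequentially o_def by blast

definition res :: "(int \<Rightarrow> real) \<Rightarrow> nat \<Rightarrow> int" where
  "res x k = \<lfloor>x (2 * int k + 1)\<rfloor>"

lemma hull_odd: assumes "x \<in> orbit_hull"
  shows "x (2 * int k + 1) = of_int (res x k)" "0 \<le> res x k" "res x k < int (per k)"
  using hull_cell[OF assms, of "2 * int k + 1"] by (auto simp: cell_def res_def)

lemma res_orbit_point: "res (orbit_point n) k = n mod int (per k)"
  by (simp add: res_def orbit_point_def)

lemma res_act: "res (act m x) k = (res x k + m) mod int (per k)"
  by (simp add: res_def act_def)

lemma tendsto_res:
  assumes "y \<longlonglongrightarrow> x" "\<And>t::nat. y t \<in> orbit_hull"
  shows "\<forall>\<^sub>F t in sequentially. res (y t) k = res x k"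
proof -
  have "(\<lambda>t. y t (2 * int k + 1)) \<longlonglongrightarrow> x (2 * int k + 1)"
    using assms(1) by (simp add: tendsto_fun_iff)
  then have "(\<lambda>t. real_of_int (res (y t) k)) \<longlonglongrightarrow> real_of_int (res x k)"
    using hull_odd(1)[OF assms(2)] hull_odd(1)[OF hull_limit[OF assms]] by simp
  then have "\<forall>\<^sub>F t in sequentially. dist (real_of_int (res (y t) k)) (real_of_int (res x k)) < 1"
    by (rule tendstoD) simp
  then show ?thesis by eventually_elim (simp add: dist_real_def)
qed

lemma res_dvd:
  assumes "(\<lambda>t. orbit_point (n t)) \<longlonglongrightarrow> x"
  shows "\<forall>\<^sub>F t in sequentially. int (per k) dvd n t - res x k"
  using tendsto_res[OF assms orbit_point_in_hull, of k]
  by eventually_elim (metis res_orbit_point mod_eq_dvd_iff mod_mod_trivial)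

lemma coherent_res: assumes "x \<in> orbit_hull" shows "coherent (res x)"
  unfolding coherent_def
proof
  fix k
  obtain n where n: "(\<lambda>t. orbit_point (n t)) \<longlonglongrightarrow> x" using hull_sequence[OF assms] .
  have "\<forall>\<^sub>F t in sequentially. int (per k) dvd res x (Suc k) - res x k"
    using res_dvd[OF n, of k] res_dvd[OF n, of "Suc k"]
  proof eventually_elim
    case (elim t)
    have "int (per k) dvd (n t - res x k) - (n t - res x (Suc k))"
      using elim(1) per_dvd_trans[OF _ elim(2), of k] by (intro dvd_diff[of _ "n t - res x k"]) auto
    then show ?case by simp
  qed
  then show "int (per k) dvd res x (Suc k) - res x k" by simp
qed

text \<open>Every coordinate of a point of the orbit depends on its time only through a residue. Minimality and the
  singleton fibre both follow from this.\<close>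
lemma orbit_point_locally_constant: "\<exists>l. \<forall>m. int (per l) dvd m - n \<longrightarrow> orbit_point m k = orbit_point n k"
proof (cases "even k")
  case True
  obtain l where l: "\<And>m. int (per l) dvd m - (n + k div 2) \<Longrightarrow> toeplitz_seq m = toeplitz_seq (n + k div 2)"
    using toeplitz_seq_locally_constant[of "n + k div 2"] by blast
  have "orbit_point m k = orbit_point n k" if "int (per l) dvd m - n" for m
    using l[of "m + k div 2"] that True by (simp add: orbit_point_def)
  then show ?thesis by blast
next
  case False
  then show ?thesis by (auto simp: orbit_point_def mod_eq_dvd_iff)
qed

section \<open>The fibre with holes\<close>

text \<open>The point \<open>\<Phi> \<kappa>\<close> of the fibre over the position 0: all its symbols are determined by the position
  except for those at the holes. Its residues are those of \<open>\<zeta>\<close>, because times are positions shifted by \<open>\<zeta>\<close>.\<close>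
definition fibre_point :: "real \<Rightarrow> int \<Rightarrow> real" where
  "fibre_point \<kappa> k = (if even k then (if k div 2 \<in> range hole then phi (inv hole (k div 2)) \<kappa> else semicocycle (\<lambda>_. k div 2))
     else of_int (hole (nat (k div 2)) mod int (per (nat (k div 2)))))"

lemma fibre_point_hole: "fibre_point \<kappa> (2 * hole i) = phi i \<kappa>"
  by (simp add: fibre_point_def inv_f_f[OF inj_hole])

text \<open>At time \<open>n\<close> the position is \<open>n - \<zeta>\<close>. If it is close to 0, then all holes within reach see the same angle,
  namely that of \<open>n - \<zeta>\<close>.\<close>
lemma toeplitz_seq_near_fibre:
  assumes "int (per (Suc i)) dvd n - hole (Suc i)"
  shows "toeplitz_seq (n + hole i) = phi i (angle (\<lambda>k. n - hole k))"
proof -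
  have "near (Suc i) (\<lambda>k. hole i) (\<lambda>k. n + hole i - hole k)"
    using assms by (simp add: near_def)
  from semicocycle_near_hole[OF _ this] show ?thesis by (simp add: toeplitz_seq_def)
qed

lemma tendsto_fibre_point:
  fixes n :: "nat \<Rightarrow> int"
  assumes zeta: "\<And>l. \<forall>\<^sub>F t in sequentially. int (per l) dvd n t - hole l"
    and angle: "(\<lambda>t. angle (\<lambda>k. n t - hole k)) \<longlonglongrightarrow> \<kappa>"
  shows "(\<lambda>t. orbit_point (n t)) \<longlonglongrightarrow> fibre_point \<kappa>"
  unfolding tendsto_fun_iff
proof
  fix k
  consider i where "even k" "k div 2 = hole i" | "even k" "k div 2 \<notin> range hole" | "odd k" by auto
  then show "(\<lambda>t. orbit_point (n t) k) \<longlonglongrightarrow> fibre_point \<kappa> k"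
  proof cases
    case 1
    have "(\<lambda>t. phi i (angle (\<lambda>k. n t - hole k))) \<longlonglongrightarrow> phi i \<kappa>"
      by (rule isCont_tendsto_compose[OF isCont_phi angle])
    moreover have "\<forall>\<^sub>F t in sequentially. phi i (angle (\<lambda>k. n t - hole k)) = orbit_point (n t) k"
      using zeta[of "Suc i"] by eventually_elim (use 1 in \<open>simp add: orbit_point_def toeplitz_seq_near_fibre\<close>)
    ultimately show ?thesis using 1 fibre_point_hole[of \<kappa> i] tendsto_cong by fastforce
  next
    case 2
    define m where "m = k div 2"
    have "nonzero (\<lambda>k. m - hole k)"
      using multiple_of_zeta_not_integer[of 1 m] by (simp add: nonzero_def)
    moreover have "nonzero (\<lambda>k. m - hole i)" for i
    proof -
      have "m - hole i \<noteq> 0" using 2 by (auto simp: m_def)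
      define l where "l = nat \<bar>m - hole i\<bar>"
      have "\<bar>m - hole i\<bar> < int (per l)"
        using le_hole[of l] four_hole_le[of l] per_pos[of l] by (simp add: l_def del: per_pos)
      with \<open>m - hole i \<noteq> 0\<close> show ?thesis
        unfolding nonzero_def by (metis dvd_imp_le_int abs_of_nat not_less)
    qed
    ultimately obtain l where l: "\<And>y. coherent y \<Longrightarrow> near l (\<lambda>_. m) y \<Longrightarrow> semicocycle y = semicocycle (\<lambda>_. m)"
      using semicocycle_locally_constant[of "\<lambda>_. m"] by auto
    have "\<forall>\<^sub>F t in sequentially. orbit_point (n t) k = fibre_point \<kappa> k"
      using zeta[of l]
    proof eventually_elim
      case (elim t)
      have "semicocycle (\<lambda>k. n t + m - hole k) = semicocycle (\<lambda>_. m)"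
        using elim by (intro l) (auto simp: near_def)
      then show ?case using 2 by (simp add: orbit_point_def fibre_point_def toeplitz_seq_def m_def)
    qed
    then show ?thesis by (rule tendsto_eventually)
  next
    case 3
    have "\<forall>\<^sub>F t in sequentially. orbit_point (n t) k = fibre_point \<kappa> k"
      using zeta[of "nat (k div 2)"]
      by eventually_elim (use 3 in \<open>simp add: orbit_point_def fibre_point_def mod_eq_dvd_iff\<close>)
    then show ?thesis by (rule tendsto_eventually)
  qed
qed

text \<open>Let \<open>x\<close> be a limit of orbit points at times \<open>n t\<close>, and let \<open>z\<close> be the limit of \<open>n t + j\<close> in the adding
  machine, so that the position belonging to the coordinate \<open>j\<close> is \<open>z - \<zeta>\<close>. If \<open>z = \<zeta>\<close>, the angles of
  the positions converge because the hole of index \<open>id_ix\<close> displays them, and \<open>x\<close> is a point of the fibre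
  with holes. Otherwise the positions of the symbols at \<open>hole i + j\<close> converge to \<open>z \<noteq> \<zeta>\<close> as \<open>i\<close> grows. If \<open>z\<close> is
  no hole, the symbol function is constant near \<open>z\<close>. If \<open>z = hole l\<close>, these positions differ from
  \<open>hole l\<close> by \<open>hole i - \<zeta>\<close>, whose angle is \<open>1 - 1 / (i + 5)\<close>, so the symbol converges to \<open>phi l 1\<close>.\<close>
lemma hole_dichotomy:
  assumes x: "x \<in> orbit_hull"
  shows "(\<exists>c. (\<lambda>i. x (2 * (hole i + j))) \<longlonglongrightarrow> c) \<or> (\<exists>\<kappa>\<in>{0..1}. x = act (- j) (fibre_point \<kappa>))"
proof -
  obtain n where n: "(\<lambda>t. orbit_point (n t)) \<longlonglongrightarrow> x" using hull_sequence[OF x] .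
  have val: "(\<lambda>t. toeplitz_seq (n t + j + hole i)) \<longlonglongrightarrow> x (2 * (hole i + j))" for i
  proof -
    have "(\<lambda>t. orbit_point (n t) (2 * (hole i + j))) \<longlonglongrightarrow> x (2 * (hole i + j))"
      using n by (simp add: tendsto_fun_iff)
    then show ?thesis by (simp add: orbit_point_def add_ac)
  qed
  have val_const: "x (2 * (hole i + j)) = c" if "\<forall>\<^sub>F t in sequentially. toeplitz_seq (n t + j + hole i) = c" for i c
    using LIMSEQ_unique[OF val tendsto_eventually[OF that]] .
  define z where "z = (\<lambda>k. res x k + j)"
  have z: "coherent z" using coherent_res[OF x] by (simp add: z_def)
  have ev: "\<forall>\<^sub>F t in sequentially. int (per l) dvd n t + j - z l" for l
    using res_dvd[OF n, of l] by (simp add: z_def)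
  show ?thesis
  proof (cases "nonzero (\<lambda>k. z k - hole k)")
    case False
    then have l: "int (per l) dvd z l - hole l" for l by (simp add: nonzero_def)
    have zeta: "\<forall>\<^sub>F t in sequentially. int (per l) dvd n t + j - hole l" for l
      using ev[of l]
    proof eventually_elim
      case (elim t)
      then have "int (per l) dvd (n t + j - z l) + (z l - hole l)" using l by (rule dvd_add)
      then show ?case by (simp add: algebra_simps)
    qed
    define \<kappa> where "\<kappa> = x (2 * (hole id_ix + j))"
    have "\<forall>\<^sub>F t in sequentially. toeplitz_seq (n t + j + hole id_ix) = angle (\<lambda>k. n t + j - hole k)"
      using zeta[of "Suc id_ix"] by eventually_elim (simp add: toeplitz_seq_near_fibre phi_id_ix angle_bounds)
    then have "(\<lambda>t. angle (\<lambda>k. n t + j - hole k)) \<longlonglongrightarrow> \<kappa>"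
      unfolding \<kappa>_def by (rule Lim_transform_eventually[OF val])
    with zeta have "(\<lambda>t. orbit_point (n t + j)) \<longlonglongrightarrow> fibre_point \<kappa>" by (rule tendsto_fibre_point)
    moreover have "(\<lambda>t. orbit_point (n t + j)) \<longlonglongrightarrow> act j x"
      using tendsto_act[OF n orbit_point_in_hull, of j] by (simp add: act_orbit_point)
    ultimately have "act j x = fibre_point \<kappa>" by (rule LIMSEQ_unique[symmetric])
    then have "x = act (- j) (fibre_point \<kappa>)" using act_inverse(1)[OF x, of j] by simp
    moreover have "\<kappa> \<in> {0..1}" using hull_cell[OF x, of "2 * (hole id_ix + j)"] by (simp add: cell_def \<kappa>_def)
    ultimately show ?thesis by blast
  next
    case True
    show ?thesis
    proof (cases "\<forall>i. nonzero (\<lambda>k. z k - hole i)")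
      case reg: True
      obtain l where l: "\<And>y. coherent y \<Longrightarrow> near l z y \<Longrightarrow> semicocycle y = semicocycle z"
        using semicocycle_locally_constant[OF z True] reg by auto
      have "\<forall>\<^sub>F t in sequentially. toeplitz_seq (n t + j + hole i) = semicocycle z" if "l \<le> i" for i
        using ev[of l]
      proof eventually_elim
        case (elim t)
        have "int (per l) dvd (n t + j - z l) + (hole i - hole l)"
          using elim hole_cong[OF that] by (rule dvd_add)
        then have "near l z (\<lambda>k. n t + j + hole i - hole k)" by (simp add: near_def algebra_simps)
        then show ?case unfolding toeplitz_seq_def by (intro l) auto
      qed
      then have "x (2 * (hole i + j)) = semicocycle z" if "l \<le> i" for i
        using that by (intro val_const)
      then have "\<forall>\<^sub>F i in sequentially. x (2 * (hole i + j)) = semicocycle z"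
        by (rule eventually_sequentiallyI)
      then have "(\<lambda>i. x (2 * (hole i + j))) \<longlonglongrightarrow> semicocycle z" by (rule tendsto_eventually)
      then show ?thesis by blast
    next
      case False
      then obtain l where l: "\<And>k. int (per k) dvd z k - hole l" by (auto simp: nonzero_def)
      have ev': "\<forall>\<^sub>F t in sequentially. int (per k) dvd n t + j - hole l" for k
        using ev[of k]
      proof eventually_elim
        case (elim t)
        then have "int (per k) dvd (n t + j - z k) + (z k - hole l)" using l by (rule dvd_add)
        then show ?case by (simp add: algebra_simps)
      qed
      have "\<forall>\<^sub>F t in sequentially. toeplitz_seq (n t + j + hole i) = phi l (1 - 1 / (real i + 5))"
        if "l < i" for i
        using ev'[of "Suc l"] ev'[of "Suc i"]
      proof eventually_elim
        case (elim t)
        let ?y = "\<lambda>k. n t + j + hole i - hole k"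
        have "int (per (Suc l)) dvd (n t + j - hole l) + (hole i - hole (Suc l))"
          using elim(1) hole_cong[of "Suc l" i] that by (intro dvd_add) auto
        then have "near (Suc l) (\<lambda>k. hole l) ?y" by (simp add: near_def algebra_simps)
        then have "toeplitz_seq (n t + j + hole i) = phi l (angle (\<lambda>k. ?y k - hole l))"
          unfolding toeplitz_seq_def by (intro semicocycle_near_hole) auto
        also have "angle (\<lambda>k. ?y k - hole l) = angle (\<lambda>k. hole i - hole k)"
        proof (rule near_level(2)[OF _ _ level_hole_diff(2)])
          show "near (Suc (level (\<lambda>k. hole i - hole k))) (\<lambda>k. hole i - hole k) (\<lambda>k. ?y k - hole l)"
            using elim(2) by (simp add: level_hole_diff near_def algebra_simps)
        qed simp_all
        finally show ?case by (simp add: angle_hole_diff)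
      qed
      then have "phi l (1 - 1 / (real i + 5)) = x (2 * (hole i + j))" if "Suc l \<le> i" for i
        using that by (intro val_const[symmetric]) simp
      then have "\<forall>\<^sub>F i in sequentially. phi l (1 - 1 / (real i + 5)) = x (2 * (hole i + j))"
        by (rule eventually_sequentiallyI)
      moreover have "(\<lambda>i. phi l (1 - 1 / (real i + 5))) \<longlonglongrightarrow> phi l 1"
      proof (rule isCont_tendsto_compose[OF isCont_phi])
        show "(\<lambda>i. 1 - 1 / (real i + 5)) \<longlonglongrightarrow> 1" by real_asymp
      qed
      ultimately have "(\<lambda>i. x (2 * (hole i + j))) \<longlonglongrightarrow> phi l 1"
        by (rule Lim_transform_eventually[rotated])
      then show ?thesis by blast
    qed
  qed
qed

section \<open>The orbit closure is a Toeplitz system\<close>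

lemma orbit_hull_coordinate:
  assumes x: "x \<in> orbit_hull" and l: "\<And>m. int (per l) dvd m - n \<Longrightarrow> orbit_point m k = c"
    and res: "int (per l) dvd res x l - n"
  shows "x k = c"
proof -
  obtain N where N: "(\<lambda>t. orbit_point (N t)) \<longlonglongrightarrow> x" using hull_sequence[OF x] .
  have "\<forall>\<^sub>F t in sequentially. orbit_point (N t) k = c"
    using res_dvd[OF N, of l]
  proof eventually_elim
    case (elim t)
    then have "int (per l) dvd (N t - res x l) + (res x l - n)" using res by (rule dvd_add)
    then show ?case by (intro l) simp
  qed
  then have "(\<lambda>t. orbit_point (N t) k) \<longlonglongrightarrow> c" by (rule tendsto_eventually)
  moreover have "(\<lambda>t. orbit_point (N t) k) \<longlonglongrightarrow> x k" using N by (simp add: tendsto_fun_iff)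
  ultimately show ?thesis by (rule LIMSEQ_unique[symmetric])
qed

abbreviation hull_space :: "(int \<Rightarrow> real) topology" where "hull_space \<equiv> top_of_set orbit_hull"

lemma homeomorphic_act: "homeomorphic_map hull_space hull_space (act m)"
proof -
  have "homeomorphic_maps hull_space hull_space (act m) (act (- m))"
    unfolding homeomorphic_maps_def by (auto simp: continuous_act act_in_hull act_inverse)
  then show ?thesis by (rule homeomorphic_maps_map[THEN iffD1, THEN conjunct1])
qed

text \<open>Moving any point \<open>x\<close> back by its own residue modulo \<open>per l\<close> makes its residue 0 there, hence makes it
  agree with the base point on all coordinates that depend on the residue modulo \<open>per l\<close>. So the base
  point is in the closure of every orbit.\<close>
lemma minimal_orbit_hull: "minimal_system hull_space (act 1)"
  unfolding minimal_system_def
proof (intro conjI allI impI)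
  show "Z_system hull_space (act 1)"
    using compact_hull by (simp add: Z_system_def homeomorphic_act compact_space_subtopology)
  show "topspace hull_space \<noteq> {}" using orbit_point_in_hull by auto
  fix A assume "closedin hull_space A \<and> act 1 ` A = A"
  then have cl: "closed A" and sub: "A \<subseteq> orbit_hull" and inv: "act 1 ` A = A"
    using closed_hull closedin_subset[of hull_space A] by (auto dest: closedin_closed_trans)
  show "A = {} \<or> A = topspace hull_space"
  proof (cases "A = {}")
    case False
    then obtain x where "x \<in> A" by auto
    have in_A: "act m y \<in> A" if y: "y \<in> A" for m y
    proof (induction m rule: int_induct[where k = 0])
      case base
      show ?case using y sub by (auto simp: act_0)
    next
      case (step1 i)
      then show ?case using inv by (metis act_act add.commute imageI)
    next
      case (step2 i)
      then obtain b where b: "b \<in> A" "act i y = act 1 b" using inv by (metis imageE)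
      then have "act (- 1) (act i y) = b" using act_inverse(1)[of b 1] sub by auto
      moreover have "act (i - 1) y = act (- 1) (act i y)" by (simp add: act_act)
      ultimately show ?case using b by simp
    qed
    have "(\<lambda>l. act (- res x l) x) \<longlonglongrightarrow> orbit_point 0"
      unfolding tendsto_fun_iff
    proof
      fix k
      obtain l where l: "\<And>m. int (per l) dvd m - 0 \<Longrightarrow> orbit_point m k = orbit_point 0 k"
        using orbit_point_locally_constant by metis
      have "act (- res x i) x k = orbit_point 0 k" if "l \<le> i" for i
      proof (rule orbit_hull_coordinate[OF _ l])
        show "act (- res x i) x \<in> orbit_hull" using in_A \<open>x \<in> A\<close> sub by blast
        have "int (per l) dvd res x l - res x i"
          using coherent_dvd_diff[OF coherent_res that] \<open>x \<in> A\<close> sub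
          by (metis dvd_minus_iff minus_diff_eq subsetD)
        then show "int (per l) dvd res (act (- res x i) x) l - 0"
          by (simp add: res_act)
      qed
      then show "(\<lambda>i. act (- res x i) x k) \<longlonglongrightarrow> orbit_point 0 k"
        by (intro tendsto_eventually eventually_sequentiallyI)
    qed
    then have "orbit_point 0 \<in> A"
      using cl in_A[OF \<open>x \<in> A\<close>] by (meson closed_sequentially)
    then have "orbit_point n \<in> A" for n using in_A[of "orbit_point 0" n] by (simp add: act_orbit_point)
    then have "orbit_hull \<subseteq> A" unfolding orbit_hull_def using cl by (intro closure_minimal) auto
    then show ?thesis using sub by auto
  qed simp
qed

lemma continuous_map_res:
  "continuous_map hull_space (adding_machine per) (\<lambda>x i. nat (res x i))"
  unfolding adding_machine_def continuous_map_in_subtopology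
proof
  show "(\<lambda>x i. nat (res x i)) \<in> topspace hull_space \<rightarrow> {g. \<forall>i. g (Suc i) mod per i = g i}"
  proof (intro funcsetI CollectI allI)
    fix x i assume "x \<in> topspace hull_space"
    then have x: "x \<in> orbit_hull" by simp
    have "res x (Suc i) mod int (per i) = res x i mod int (per i)"
      using coherent_res[OF x] by (simp add: coherent_def mod_eq_dvd_iff)
    also have "\<dots> = res x i" using hull_odd[OF x] by simp
    finally show "nat (res x (Suc i)) mod per i = nat (res x i)"
      using hull_odd(2)[OF x] by (metis nat_int nat_mod_distrib of_nat_0_le_iff)
  qed
  show "continuous_map hull_space (product_topology (\<lambda>i. discrete_topology {0..<per i}) UNIV) (\<lambda>x i. nat (res x i))"
    unfolding continuous_map_componentwise_UNIV
  proof
    fix i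
    show "continuous_map hull_space (discrete_topology {0..<per i}) (\<lambda>x. nat (res x i))"
      unfolding continuous_map_def
    proof (intro conjI allI impI)
      show "(\<lambda>x. nat (res x i)) \<in> topspace hull_space \<rightarrow> topspace (discrete_topology {0..<per i})"
        using hull_odd by (auto simp: nat_less_iff)
      fix U :: "nat set"
      have "{x \<in> orbit_hull. nat (res x i) \<in> U} =
        orbit_hull \<inter> (\<lambda>x. x (2 * int i + 1)) -` (\<Union>r\<in>U. ball (real r) 1)"
      proof (intro set_eqI iffI)
        fix x assume "x \<in> {x \<in> orbit_hull. nat (res x i) \<in> U}"
        then show "x \<in> orbit_hull \<inter> (\<lambda>x. x (2 * int i + 1)) -` (\<Union>r\<in>U. ball (real r) 1)"
          using hull_odd[of x i] by (auto intro!: bexI[of _ "nat (res x i)"] simp: dist_real_def)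
      next
        fix x assume "x \<in> orbit_hull \<inter> (\<lambda>x. x (2 * int i + 1)) -` (\<Union>r\<in>U. ball (real r) 1)"
        then obtain r where r: "x \<in> orbit_hull" "r \<in> U" "\<bar>real r - x (2 * int i + 1)\<bar> < 1"
          by (auto simp: dist_real_def)
        then have "res x i = int r" using hull_odd(1)[of x i] by simp
        with r show "x \<in> {x \<in> orbit_hull. nat (res x i) \<in> U}" by simp
      qed
      moreover have "open ((\<lambda>x::int \<Rightarrow> real. x (2 * int i + 1)) -` (\<Union>r\<in>U. ball (real r) 1))"
        by (intro open_vimage continuous_on_product_coordinates open_UN ballI open_ball)
      ultimately show "openin hull_space {x \<in> topspace hull_space. nat (res x i) \<in> U}"
        by (simp add: openin_open_Int)
    qed
  qed
qed

lemma topspace_adding_machine: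
  "topspace (adding_machine p) = {g. (\<forall>i. g i < p i) \<and> (\<forall>i. g (Suc i) mod p i = g i)}"
  by (auto simp: adding_machine_def PiE_iff)

text \<open>The factor map reads off the residues. Its fibre over 0 is the base point alone, because a coordinate of
  the base point is determined by a residue.\<close>
lemma toeplitz_orbit_hull: "toeplitz_system hull_space (act 1)"
  unfolding toeplitz_system_def
proof (intro conjI exI[of _ per])
  show "minimal_system hull_space (act 1)" by (rule minimal_orbit_hull)
  show "metrizable_space hull_space" by (simp add: metrizable_space_euclidean metrizable_space_subtopology)
  have "k \<le> per k" for k
    using le_hole[of k] four_hole_le[of k] hole_nonneg[of k] by linarith
  then show "adding_machine_base per"
    unfolding adding_machine_base_def
    by (auto intro: per_dvd filterlim_at_top_mono[OF filterlim_ident])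
  show "almost_one_to_one_extension hull_space (act 1) (adding_machine per) (add_one per)"
    unfolding almost_one_to_one_extension_def
  proof (intro exI[of _ "\<lambda>x i. nat (res x i)"] conjI ballI)
    show c: "continuous_map hull_space (adding_machine per) (\<lambda>x i. nat (res x i))"
      by (rule continuous_map_res)
    show "(\<lambda>x i. nat (res x i)) ` topspace hull_space = topspace (adding_machine per)"
    proof
      show "(\<lambda>x i. nat (res x i)) ` topspace hull_space \<subseteq> topspace (adding_machine per)"
        using c by (rule continuous_map_image_subset_topspace)
      show "topspace (adding_machine per) \<subseteq> (\<lambda>x i. nat (res x i)) ` topspace hull_space"
      proof
        fix g assume g: "g \<in> topspace (adding_machine per)"
        then have gi: "g i < per i" "g (Suc i) mod per i = g i" for i
          by (auto simp: topspace_adding_machine)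
        have "coherent (\<lambda>i. int (g i))"
          unfolding coherent_def
        proof
          fix k
          have "int (g (Suc k)) mod int (per k) = int (g k) mod int (per k)"
            using gi(2)[of k] gi(1)[of k] by (metis mod_less zmod_int)
          then show "int (per k) dvd int (g (Suc k)) - int (g k)" by (simp add: mod_eq_dvd_iff)
        qed
        obtain x r where x: "x \<in> orbit_hull" and r: "strict_mono (r :: nat \<Rightarrow> nat)"
          "((\<lambda>t. orbit_point (int (g t))) \<circ> r) \<longlonglongrightarrow> x"
          using compact_hull[unfolded compact_eq_seq_compact_metric seq_compact_def] orbit_point_in_hull by metis
        have "nat (res x i) = g i" for i
        proof -
          have lim: "(\<lambda>t. orbit_point (int (g (r t)))) \<longlonglongrightarrow> x" using r(2) by (simp add: o_def)
          have "\<forall>\<^sub>F t in sequentially. int (per i) dvd int (g i) - res x i"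
            using res_dvd[OF lim, of i] eventually_ge_at_top[of i]
          proof eventually_elim
            case (elim t)
            have "i \<le> r t" using elim(2) seq_suble[OF r(1), of t] by simp
            then have "int (per i) dvd (int (g (r t)) - res x i) - (int (g (r t)) - int (g i))"
              using coherent_dvd_diff[OF \<open>coherent (\<lambda>i. int (g i))\<close>] elim(1) by (blast intro: dvd_diff)
            then show ?case by simp
          qed
          then have "int (g i) mod int (per i) = res x i mod int (per i)" by (simp add: mod_eq_dvd_iff)
          then have "int (g i) = res x i" using gi(1)[of i] hull_odd[OF x, of i] by simp
          then show ?thesis by simp
        qed
        then show "g \<in> (\<lambda>x i. nat (res x i)) ` topspace hull_space" using x by (auto intro!: image_eqI[of _ _ x])
      qed
    qed
    show "(\<lambda>i. nat (res (act 1 x) i)) = add_one per (\<lambda>i. nat (res x i))" if "x \<in> topspace hull_space" for x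
    proof
      fix i
      have "0 \<le> res x i" using hull_odd(2)[of x i] that by simp
      then show "nat (res (act 1 x) i) = add_one per (\<lambda>i. nat (res x i)) i"
        by (simp add: add_one_def res_act nat_mod_distrib nat_add_distrib)
    qed
    show "\<exists>g\<in>topspace (adding_machine per). is_singleton {x \<in> topspace hull_space. (\<lambda>i. nat (res x i)) = g}"
    proof (intro bexI[of _ "\<lambda>i. 0"])
      have "x = orbit_point 0" if x: "x \<in> orbit_hull" "\<And>i. nat (res x i) = 0" for x
      proof
        fix k
        obtain l where l: "\<And>m. int (per l) dvd m - 0 \<Longrightarrow> orbit_point m k = orbit_point 0 k"
          using orbit_point_locally_constant by metis
        have "res x l = 0" using x(2)[of l] hull_odd(2)[OF x(1), of l] by simp
        then show "x k = orbit_point 0 k" 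
          by (intro orbit_hull_coordinate[OF x(1), where l = l and n = 0] l) simp_all
      qed
      then have "{x \<in> topspace hull_space. (\<lambda>i. nat (res x i)) = (\<lambda>i. 0)} = {orbit_point 0}"
        by (auto simp: fun_eq_iff orbit_point_in_hull res_orbit_point)
      then show "is_singleton {x \<in> topspace hull_space. (\<lambda>i. nat (res x i)) = (\<lambda>i. 0)}" by simp
      show "(\<lambda>i. 0) \<in> topspace (adding_machine per)" by (simp add: topspace_adding_machine)
    qed
  qed
qed

section \<open>Bumps that separate countable sets from diffuse measures\<close>

lemma infdist_ge:
  assumes "A \<noteq> {}" "\<And>a. a \<in> A \<Longrightarrow> d \<le> dist x a" shows "d \<le> infdist x A"
  unfolding infdist_notempty[OF assms(1)] using assms by (intro cINF_greatest)

text \<open>Enumerate \<open>S\<close> and the measures. The closed \<open>2 / (m + 1)\<close>-neighbourhoods of finitely many points of \<open>S\<close>, with \<open>S\<close>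
  removed, decrease to the empty set as \<open>m\<close> grows, so their measures tend to 0. The bump number \<open>r\<close> sits
  on the first \<open>r + 1\<close> points of \<open>S\<close> and is so narrow that its support without \<open>S\<close> has mass below
  \<open>2^(-r)\<close> for each of the first \<open>r + 1\<close> measures; the Borel-Cantelli lemma does the rest.\<close>
lemma separating_bumps:
  fixes N :: "real measure set" and S :: "real set"
  assumes N: "countable N" "\<And>\<nu>. \<nu> \<in> N \<Longrightarrow> finite_measure \<nu>" "\<And>\<nu>. \<nu> \<in> N \<Longrightarrow> sets \<nu> = sets borel"
    and S: "countable S" "S \<noteq> {}"
  obtains i :: "nat \<Rightarrow> nat" where "filterlim i at_top sequentially"
    "\<And>\<kappa>. \<kappa> \<in> S \<Longrightarrow> (\<lambda>r. phi (i r) \<kappa>) \<longlonglongrightarrow> 1"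
    "\<And>\<nu>. \<nu> \<in> N \<Longrightarrow> AE \<kappa> in \<nu>. \<kappa> \<notin> S \<longrightarrow> (\<lambda>r. phi (i r) \<kappa>) \<longlonglongrightarrow> 0"
proof -
  \<comment> \<open>The null measure is added only to have a nonempty set to enumerate.\<close>
  define N' where "N' = insert (null_measure borel) N"
  define \<nu> where "\<nu> = from_nat_into N'"
  have range_\<nu>: "range \<nu> = N'"
    unfolding \<nu>_def N'_def using N(1) by (intro range_from_nat_into) auto
  have fin: "finite_measure (\<nu> l)" and sets: "sets (\<nu> l) = sets borel" for l
  proof -
    have "\<nu> l \<in> N'" using range_\<nu> by blast
    moreover have "finite_measure (null_measure borel)" by (rule finite_measureI) simp
    ultimately show "finite_measure (\<nu> l)" "sets (\<nu> l) = sets borel"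
      using N by (auto simp: N'_def)
  qed
  have S_sets: "S \<in> sets borel" using S(1) by (rule sets.countable[rotated]) simp
  define s where "s = from_nat_into S"
  have range_s: "range s = S" unfolding s_def using S by (intro range_from_nat_into)
  define D where "D r m = (\<Union>f\<in>s ` {..r}. cball f (2 / (real m + 1)))" for r m :: nat
  have D_sets: "D r m - S \<in> sets (\<nu> l)" for r m l
    unfolding sets D_def using S_sets by (intro sets.Diff sets.finite_UN) auto
  have ex: "\<exists>m\<ge>r. \<forall>l\<le>r. measure (\<nu> l) (D r m - S) < (1/2) ^ r" for r
  proof -
    have "\<forall>\<^sub>F m in sequentially. measure (\<nu> l) (D r m - S) < (1/2) ^ r" for l
    proof -
      interpret finite_measure "\<nu> l" by (rule fin)
      have "(\<Inter>m. D r m - S) = {}"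
      proof (rule ccontr)
        assume "(\<Inter>m. D r m - S) \<noteq> {}"
        then obtain t where t: "t \<notin> S" "\<And>m. t \<in> D r m" by auto
        define d where "d = infdist t (s ` {..r})"
        have "t \<notin> s ` {..r}" using t(1) range_s by auto
        then have "d > 0"
          unfolding d_def by (intro infdist_pos_not_in_closed finite_imp_closed) auto
        moreover have "(\<lambda>m. 2 / (real m + 1)) \<longlonglongrightarrow> 0" by real_asymp
        ultimately have "\<forall>\<^sub>F m in sequentially. 2 / (real m + 1) < d" by (rule order_tendstoD(2)[rotated])
        then obtain m where m: "2 / (real m + 1) < d" by (auto simp: eventually_sequentially)
        obtain f where "f \<in> s ` {..r}" "dist f t \<le> 2 / (real m + 1)"
          using t(2)[of m] unfolding D_def by auto
        then show False using m infdist_le[of f "s ` {..r}" t] by (simp add: d_def dist_commute)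
      qed
      moreover have "decseq (\<lambda>m. D r m - S)"
        unfolding decseq_def D_def
        by (intro allI impI Diff_mono UN_mono subset_cball order.refl) (simp add: frac_le)
      ultimately have "(\<lambda>m. measure (\<nu> l) (D r m - S)) \<longlonglongrightarrow> 0"
        using finite_Lim_measure_decseq[of "\<lambda>m. D r m - S"] D_sets
        by (simp only: measure_empty image_subset_iff ball_UNIV simp_thms)
      then show ?thesis by (rule order_tendstoD) simp
    qed
    then have "\<forall>\<^sub>F m in sequentially. \<forall>l\<in>{..r}. measure (\<nu> l) (D r m - S) < (1/2) ^ r"
      by (intro eventually_ball_finite) auto
    then have "\<forall>\<^sub>F m in sequentially. r \<le> m \<and> (\<forall>l\<in>{..r}. measure (\<nu> l) (D r m - S) < (1/2) ^ r)"
      using eventually_ge_at_top by (rule eventually_conj[rotated])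
    then show ?thesis by (auto simp: eventually_sequentially)
  qed
  then obtain m where m: "\<And>r. r \<le> m r" "\<And>r l. l \<le> r \<Longrightarrow> measure (\<nu> l) (D r (m r) - S) < (1/2) ^ r"
    by metis
  have rat_near: "\<exists>q::rat. \<bar>t - real_of_rat q\<bar> < \<epsilon>" if pos: "0 < \<epsilon>" for t \<epsilon> :: real
  proof -
    obtain q where "t - \<epsilon> < real_of_rat q" "real_of_rat q < t + \<epsilon>"
      using of_rat_dense[of "t - \<epsilon>" "t + \<epsilon>"] pos by auto
    then have "\<bar>t - real_of_rat q\<bar> < \<epsilon>" by linarith
    then show ?thesis by blast
  qed
  define q :: "real \<Rightarrow> real \<Rightarrow> rat" where "q t \<epsilon> = (SOME q. \<bar>t - real_of_rat q\<bar> < \<epsilon>)" for t \<epsilon>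
  have q: "\<bar>t - real_of_rat (q t \<epsilon>)\<bar> < \<epsilon>" if "0 < \<epsilon>" for t \<epsilon>
    unfolding q_def using rat_near[OF that] by (rule someI_ex)
  \<comment> \<open>The centres have to be rational. An error below \<open>1 / (m + 1)^2\<close> costs at most \<open>1 / (m + 1)\<close> in height
    at slope \<open>m + 1\<close>, and the supports still lie within distance \<open>2 / (m + 1)\<close> of the exact centres.\<close>
  define \<epsilon> where "\<epsilon> r = 1 / (real (m r) + 1)\<^sup>2" for r
  have \<epsilon>: "0 < \<epsilon> r" for r by (simp add: \<epsilon>_def add_pos_nonneg add.commute)
  define L where "L r = map (\<lambda>l. q (s l) (\<epsilon> r)) [0..<Suc r]" for r
  have set_L: "set (L r) = (\<lambda>l. q (s l) (\<epsilon> r)) ` {..r}" for r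
    by (simp only: L_def set_map set_upt atLeast0_lessThan_Suc atLeast0LessThan lessThan_Suc_atMost)
  define i where "i r = prod_encode (to_nat (L r, m r + 1), r)" for r
  have phi_i: "phi (i r) = bump (L r, m r + 1)" for r by (simp add: i_def phi_code)
  show ?thesis
  proof (rule that)
    show "filterlim i at_top sequentially"
      by (rule filterlim_at_top_mono[OF filterlim_ident]) (simp add: i_def le_prod_encode_2)
    show "(\<lambda>r. phi (i r) \<kappa>) \<longlonglongrightarrow> 1" if \<kappa>: "\<kappa> \<in> S" for \<kappa>
    proof -
      obtain l where l: "\<kappa> = s l" using \<kappa> range_s by auto
      have low: "1 - 1 / (real r + 1) \<le> phi (i r) \<kappa>" if "l \<le> r" for r
      proof -
        have "infdist \<kappa> (real_of_rat ` set (L r)) \<le> dist \<kappa> (real_of_rat (q (s l) (\<epsilon> r)))"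
          using that by (intro infdist_le) (auto simp: set_L)
        also have "\<dots> \<le> \<epsilon> r" using q[OF \<epsilon>, of "s l"] by (simp add: l dist_real_def less_imp_le)
        finally have "real (m r + 1) * infdist \<kappa> (real_of_rat ` set (L r)) \<le> real (m r + 1) * \<epsilon> r"
          by (intro mult_left_mono) auto
        also have "\<dots> = 1 / (real (m r) + 1)" by (simp add: \<epsilon>_def power2_eq_square add.commute)
        also have "\<dots> \<le> 1 / (real r + 1)" using m(1)[of r] by (simp add: frac_le)
        finally show ?thesis unfolding phi_i bump_def by simp
      qed
      show ?thesis
      proof (rule tendsto_sandwich)
        show "\<forall>\<^sub>F r in sequentially. 1 - 1 / (real r + 1) \<le> phi (i r) \<kappa>"
          using low by (rule eventually_sequentiallyI)
        show "\<forall>\<^sub>F r in sequentially. phi (i r) \<kappa> \<le> 1" by (simp add: phi_bounds)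
        show "(\<lambda>r. 1 - 1 / (real r + 1)) \<longlonglongrightarrow> 1" by real_asymp
      qed simp
    qed
    have zero: "phi (i r) \<kappa> = 0" if "\<kappa> \<notin> D r (m r)" for r \<kappa>
    proof -
      have "1 / (real (m r) + 1) \<le> infdist \<kappa> (real_of_rat ` set (L r))"
      proof (rule infdist_ge)
        show "real_of_rat ` set (L r) \<noteq> {}" by (simp add: set_L)
        fix a assume "a \<in> real_of_rat ` set (L r)"
        then obtain l where l: "l \<le> r" "a = real_of_rat (q (s l) (\<epsilon> r))" by (auto simp: set_L)
        have 1: "2 / (real (m r) + 1) < dist (s l) \<kappa>"
          using that l(1) by (auto simp: D_def not_le)
        have 2: "dist (s l) a \<le> \<epsilon> r" using q[OF \<epsilon>, of "s l"] by (simp add: l dist_real_def less_imp_le)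
        have "1 / (real (m r) + 1) * (1 / (real (m r) + 1)) \<le> 1 / (real (m r) + 1) * 1"
          by (intro mult_left_mono) auto
        then have 3: "\<epsilon> r \<le> 1 / (real (m r) + 1)" by (simp add: \<epsilon>_def power2_eq_square)
        have 4: "2 / (real (m r) + 1) = 1 / (real (m r) + 1) + 1 / (real (m r) + 1)" by simp
        show "1 / (real (m r) + 1) \<le> dist \<kappa> a"
          using 1 2 3 dist_triangle[of "s l" \<kappa> a] unfolding 4 by (simp add: dist_commute)
      qed
      then have "(real (m r) + 1) * (1 / (real (m r) + 1)) \<le> (real (m r) + 1) * infdist \<kappa> (real_of_rat ` set (L r))"
        by (intro mult_left_mono) auto
      moreover have "(real (m r) + 1) * (1 / (real (m r) + 1)) = 1" by simp
      ultimately show ?thesis unfolding phi_i bump_def by (simp add: add.commute)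
    qed
    show "AE \<kappa> in \<mu>. \<kappa> \<notin> S \<longrightarrow> (\<lambda>r. phi (i r) \<kappa>) \<longlonglongrightarrow> 0" if \<mu>: "\<mu> \<in> N" for \<mu>
    proof -
      obtain l where l: "\<mu> = \<nu> l" using \<mu> range_\<nu> unfolding N'_def by blast
      interpret finite_measure "\<nu> l" by (rule fin)
      have "AE \<kappa> in \<nu> l. \<forall>\<^sub>F r in sequentially. \<kappa> \<in> space (\<nu> l) - (D r (m r) - S)"
      proof (rule borel_cantelli_AE1)
        show "D r (m r) - S \<in> sets (\<nu> l)" for r by (rule D_sets)
        show "emeasure (\<nu> l) (D r (m r) - S) < \<infinity>" for r by (simp add: less_top[symmetric])
        have "\<forall>\<^sub>F r in sequentially. norm (measure (\<nu> l) (D r (m r) - S)) \<le> (1/2) ^ r"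
          using m(2) by (intro eventually_sequentiallyI[of l]) (auto simp: less_imp_le)
        moreover have "summable (\<lambda>r. (1/2 :: real) ^ r)" by (simp add: summable_geometric)
        ultimately show "summable (\<lambda>r. measure (\<nu> l) (D r (m r) - S))"
          by (rule summable_comparison_test_ev)
      qed
      then show ?thesis unfolding l
      proof eventually_elim
        case (elim \<kappa>)
        show ?case
        proof
          assume "\<kappa> \<notin> S"
          with elim have "\<forall>\<^sub>F r in sequentially. phi (i r) \<kappa> = 0"
            by (auto elim!: eventually_mono intro: zero)
          then show "(\<lambda>r. phi (i r) \<kappa>) \<longlonglongrightarrow> 0" by (rule tendsto_eventually)
        qed
      qed
    qed
  qed
qed

section \<open>Limits of powers on the system\<close>

text \<open>The common limit of \<open>act (hole (i r)) x\<close> along all sequences \<open>i r \<rightarrow> \<infinity>\<close> for which \<open>phi (i r)\<close> tends to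
  \<open>c\<close> at the parameter of \<open>x\<close>, should \<open>x\<close> lie in a fibre with holes. The residues of \<open>hole i\<close>
  modulo \<open>per l\<close> are constant for \<open>i \<ge> l\<close>, which explains the odd coordinates.\<close>
definition limit_pt :: "real \<Rightarrow> (int \<Rightarrow> real) \<Rightarrow> int \<Rightarrow> real" where
  "limit_pt c x k = (if even k then
       (if convergent (\<lambda>i. x (k + 2 * hole i)) then lim (\<lambda>i. x (k + 2 * hole i)) else c)
     else act (hole (nat (k div 2))) x k)"

lemma act_fibre_point_hole: "act (- j) (fibre_point \<kappa>) (2 * (hole i + j)) = phi i \<kappa>"
  using fibre_point_hole[of \<kappa> i] by (simp add: act_def algebra_simps)

lemma tendsto_limit_pt:
  assumes x: "x \<in> orbit_hull" and i: "filterlim i at_top sequentially"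
    and c: "\<And>j \<kappa>. 0 \<le> \<kappa> \<Longrightarrow> \<kappa> \<le> 1 \<Longrightarrow> x = act (- j) (fibre_point \<kappa>) \<Longrightarrow> (\<lambda>r. phi (i r) \<kappa>) \<longlonglongrightarrow> c"
  shows "(\<lambda>r::nat. act (hole (i r)) x) \<longlonglongrightarrow> limit_pt c x"
  unfolding tendsto_fun_iff
proof
  fix k
  show "(\<lambda>r. act (hole (i r)) x k) \<longlonglongrightarrow> limit_pt c x k"
  proof (cases "even k")
    case True
    then have k: "k + 2 * hole i = 2 * (hole i + k div 2)" for i by auto
    show ?thesis
    proof (cases "convergent (\<lambda>i. x (k + 2 * hole i))")
      case conv: True
      then have "(\<lambda>i. x (k + 2 * hole i)) \<longlonglongrightarrow> limit_pt c x k"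
        using True by (simp add: limit_pt_def convergent_LIMSEQ_iff)
      from filterlim_compose[OF this i] show ?thesis using True by (simp add: act_def)
    next
      case False
      then have "\<nexists>l. (\<lambda>i. x (2 * (hole i + k div 2))) \<longlonglongrightarrow> l"
        unfolding k convergent_def .
      then obtain \<kappa> where \<kappa>: "\<kappa> \<in> {0..1}" "x = act (- (k div 2)) (fibre_point \<kappa>)"
        using hole_dichotomy[OF x, of "k div 2"] by blast
      have "act (hole (i r)) x k = phi (i r) \<kappa>" for r
        using True act_fibre_point_hole[of "k div 2" \<kappa> "i r"] by (simp add: act_def[of "hole (i r)"] k \<kappa>(2))
      moreover have "limit_pt c x k = c" using True False by (simp add: limit_pt_def)
      ultimately show ?thesis using c[of \<kappa> "k div 2"] \<kappa> by simp
    qed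
  next
    case False
    let ?l = "nat (k div 2)"
    have "\<forall>\<^sub>F r in sequentially. ?l \<le> i r" using i by (simp add: filterlim_at_top)
    then have "\<forall>\<^sub>F r in sequentially. act (hole (i r)) x k = limit_pt c x k"
    proof eventually_elim
      case (elim r)
      show ?case using False hole_cong[OF elim] by (simp add: limit_pt_def act_def mod_eq_dvd_iff)
    qed
    then show ?thesis by (rule tendsto_eventually)
  qed
qed

text \<open>The parameter \<open>\<kappa>\<close> is reached along times whose position has \<open>\<lfloor>\<kappa> * (t + 5)\<rfloor>\<close> as its first nonzero digit, at
  level \<open>t\<close>. As \<open>\<kappa> > 0\<close>, this number is eventually nonzero.\<close>
lemma fibre_point_in_hull:
  assumes "0 < \<kappa>" "\<kappa> < 1" shows "fibre_point \<kappa> \<in> orbit_hull"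
proof -
  define d where "d t = \<lfloor>\<kappa> * (real t + 5)\<rfloor>" for t :: nat
  define n where "n t = hole (Suc t) + d t * int (per t)" for t
  have d_less: "d t < int t + 5" for t
    using assms mult_strict_right_mono[of \<kappa> 1 "real t + 5"] by (simp add: d_def floor_less_iff)
  have "filterlim (\<lambda>t. \<kappa> * (real t + 5)) at_top sequentially" using assms(1) by real_asymp
  then have "\<forall>\<^sub>F t in sequentially. 1 \<le> \<kappa> * (real t + 5)" by (simp add: filterlim_at_top)
  then have d_pos: "\<forall>\<^sub>F t in sequentially. 0 < d t"
    by eventually_elim (simp add: d_def zero_less_floor)
  have angle: "angle (\<lambda>k. n t - hole k) = real_of_int (d t) / (real t + 5)" if "0 < d t" for t
  proof -
    have bd: "0 < d t * int (per t)" "d t * int (per t) < int (per (Suc t))"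
      using that d_less[of t] mult_strict_right_mono[OF d_less[of t], of "int (per t)"] by (simp_all add: per_Suc add.commute)
    have "level (\<lambda>k. n t - hole k) = t"
    proof (rule level_eqI)
      show "int (per t) dvd n t - hole t" by (simp add: n_def hole_Suc)
      show "\<not> int (per (Suc t)) dvd n t - hole (Suc t)"
        using bd zdvd_not_zless by (simp add: n_def)
    qed simp
    moreover have "(d t * int (per t)) mod int (per (Suc t)) = d t * int (per t)"
      using bd by (intro mod_pos_pos_trivial) simp_all
    ultimately show ?thesis unfolding angle_def by (simp add: n_def) (simp add: per_Suc add.commute)
  qed
  have "(\<lambda>t. orbit_point (n t)) \<longlonglongrightarrow> fibre_point \<kappa>"
  proof (rule tendsto_fibre_point)
    show "\<forall>\<^sub>F t in sequentially. int (per l) dvd n t - hole l" for l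
    proof (rule eventually_sequentiallyI[of l])
      fix t assume "l \<le> t"
      then have "int (per l) dvd (hole (Suc t) - hole l) + d t * int (per t)"
        using hole_cong[of l "Suc t"] per_dvd[of l t] by (intro dvd_add dvd_mult) auto
      then show "int (per l) dvd n t - hole l" by (simp add: n_def algebra_simps)
    qed
    have "(\<lambda>t. real_of_int (d t) / (real t + 5)) \<longlonglongrightarrow> \<kappa>"
    proof (rule tendsto_sandwich)
      show "\<forall>\<^sub>F t in sequentially. \<kappa> - 1 / (real t + 5) \<le> real_of_int (d t) / (real t + 5)"
      proof (intro always_eventually allI)
        fix t
        have "\<kappa> * (real t + 5) - 1 \<le> real_of_int (d t)" unfolding d_def by linarith
        then have "(\<kappa> * (real t + 5) - 1) / (real t + 5) \<le> real_of_int (d t) / (real t + 5)"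
          by (intro divide_right_mono) auto
        then show "\<kappa> - 1 / (real t + 5) \<le> real_of_int (d t) / (real t + 5)" by (simp add: diff_divide_distrib)
      qed
      show "\<forall>\<^sub>F t in sequentially. real_of_int (d t) / (real t + 5) \<le> \<kappa>"
      proof (intro always_eventually allI)
        fix t
        have "real_of_int (d t) \<le> \<kappa> * (real t + 5)" unfolding d_def by linarith
        then show "real_of_int (d t) / (real t + 5) \<le> \<kappa>" by (simp add: divide_le_eq)
      qed
      show "(\<lambda>t. \<kappa> - 1 / (real t + 5)) \<longlonglongrightarrow> \<kappa>" by real_asymp
    qed simp
    then show "(\<lambda>t. angle (\<lambda>k. n t - hole k)) \<longlonglongrightarrow> \<kappa>"
      by (rule Lim_transform_eventually) (use d_pos in eventually_elim, simp add: angle)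
  qed
  then show ?thesis by (rule hull_limit) (rule orbit_point_in_hull)
qed

lemma limit_pt_fibre_point:
  assumes "0 < \<kappa>" "\<kappa> < 1"
  shows "limit_pt 1 (fibre_point \<kappa>) 0 = 1" "limit_pt 0 (fibre_point \<kappa>) 0 = 0"
proof -
  have nc: "\<not> convergent (\<lambda>i. phi i \<kappa>)"
  proof
    assume "convergent (\<lambda>i. phi i \<kappa>)"
    then obtain l where l: "(\<lambda>i. phi i \<kappa>) \<longlonglongrightarrow> l" by (auto simp: convergent_def)
    have "(\<lambda>n. phi (one_ix n) \<kappa>) \<longlonglongrightarrow> l" "(\<lambda>n. phi (zero_ix n) \<kappa>) \<longlonglongrightarrow> l"
      using filterlim_compose[OF l filterlim_one_ix] filterlim_compose[OF l filterlim_zero_ix] .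
    then show False using assms LIMSEQ_unique[of "\<lambda>n. 1::real" 1 l] LIMSEQ_unique[of "\<lambda>n. 0::real" 0 l]
      by (simp add: phi_one_ix phi_zero_ix)
  qed
  then show "limit_pt 1 (fibre_point \<kappa>) 0 = 1" "limit_pt 0 (fibre_point \<kappa>) 0 = 0"
    by (simp_all add: limit_pt_def fibre_point_hole)
qed

section \<open>Powers on the space of measures\<close>

lemma orbit_hull_borel [measurable]: "orbit_hull \<in> sets borel"
  using closed_hull by simp

lemma space_borel_of: "space (borel_of X) = topspace X"
  by (simp add: borel_of_def space_measure_of_conv)

lemma sets_borel_of_X: "sets (borel_of hull_space) = sets (restrict_space borel orbit_hull)"
proof -
  have "{U. openin hull_space U} \<subseteq> Pow orbit_hull" using openin_subset by fastforce
  then have "sets (borel_of hull_space) = sigma_sets orbit_hull {U. openin hull_space U}"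
    by (simp add: borel_of_def)
  also have "{U. openin hull_space U} = (\<inter>) orbit_hull ` {S. open S}"
    by (auto simp: openin_open)
  also have "sigma_sets orbit_hull \<dots> = (\<inter>) orbit_hull ` sigma_sets UNIV {S. open S}"
    by (rule sigma_sets_Int[symmetric]) (use orbit_hull_borel in \<open>auto simp: borel_def\<close>)
  also have "\<dots> = sets (restrict_space borel orbit_hull)"
    by (simp add: sets_restrict_space borel_def)
  finally show ?thesis .
qed

lemma measurable_into_X:
  assumes "f \<in> borel_measurable M" "\<And>x. x \<in> space M \<Longrightarrow> f x \<in> orbit_hull"
  shows "f \<in> M \<rightarrow>\<^sub>M borel_of hull_space"
proof -
  have "f \<in> M \<rightarrow>\<^sub>M restrict_space borel orbit_hull"
    using assms by (intro measurable_restrict_space2) auto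
  then show ?thesis by (simp cong: measurable_cong_sets add: sets_borel_of_X)
qed

lemma measurable_from_X:
  fixes f :: "(int \<Rightarrow> real) \<Rightarrow> 'b::topological_space"
  assumes "continuous_on orbit_hull f" shows "f \<in> borel_measurable (borel_of hull_space)"
  using borel_measurable_continuous_on_restrict[OF assms]
  by (simp cong: measurable_cong_sets add: sets_borel_of_X)

lemma measurable_act: "act m \<in> borel_of hull_space \<rightarrow>\<^sub>M borel_of hull_space"
  by (rule measurable_into_X[OF measurable_from_X[OF continuous_act]])
    (simp add: space_borel_of act_in_hull)

lemma singleton_in_sets: "x \<in> orbit_hull \<Longrightarrow> {x} \<in> sets (borel_of hull_space)"
  by (auto simp: sets_borel_of_X sets_restrict_space intro!: image_eqI[of _ _ "{x}"])

lemma borel_probabilitiesD: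
  assumes "\<mu> \<in> borel_probabilities X"
  shows "prob_space \<mu>" "sets \<mu> = sets (borel_of X)" "space \<mu> = topspace X"
  using assms sets_eq_imp_space_eq[of \<mu> "borel_of X"] by (auto simp: borel_probabilities_def space_borel_of)

lemma measurable_borel_probability:
  assumes "\<mu> \<in> borel_probabilities X" "f \<in> borel_of X \<rightarrow>\<^sub>M N" shows "f \<in> \<mu> \<rightarrow>\<^sub>M N"
  using assms(2) measurable_cong_sets[OF borel_probabilitiesD(2)[OF assms(1)] refl, of N] by simp

lemma distr_in_borel_probabilities:
  assumes "prob_space \<mu>" "f \<in> \<mu> \<rightarrow>\<^sub>M borel_of X"
  shows "distr \<mu> (borel_of X) f \<in> borel_probabilities X"
  using prob_space.prob_space_distr[OF assms] by (simp add: borel_probabilities_def)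

lemma prob_map_funpow:
  assumes \<mu>: "\<mu> \<in> borel_probabilities hull_space"
  shows "(prob_map hull_space (act 1) ^^ n) \<mu> = distr \<mu> (borel_of hull_space) (act (int n))"
proof (induction n)
  case 0
  have "distr \<mu> (borel_of hull_space) (act 0) = distr \<mu> \<mu> (\<lambda>x. x)"
    using borel_probabilitiesD[OF \<mu>] by (intro distr_cong) (auto simp: act_0)
  then show ?case by simp
next
  case (Suc n)
  have m: "act (int n) \<in> \<mu> \<rightarrow>\<^sub>M borel_of hull_space"
    by (rule measurable_borel_probability[OF \<mu> measurable_act])
  have "(prob_map hull_space (act 1) ^^ Suc n) \<mu> = prob_map hull_space (act 1) (distr \<mu> (borel_of hull_space) (act (int n)))"
    using Suc by simp
  also have "\<dots> = distr \<mu> (borel_of hull_space) (act 1 \<circ> act (int n))"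
    unfolding prob_map_def by (rule distr_distr[OF measurable_act m])
  also have "act 1 \<circ> act (int n) = act (int (Suc n))" by (auto simp: act_act)
  finally show ?case .
qed

lemma limitin_prob_topology:
  assumes "\<And>r. \<mu> r \<in> borel_probabilities X" "\<nu> \<in> borel_probabilities X"
    and "\<And>f. continuous_map X euclideanreal f \<Longrightarrow> ((\<lambda>r. LINT x|\<mu> r. f x) \<longlongrightarrow> (LINT x|\<nu>. f x)) F"
  shows "limitin (prob_topology X) \<mu> \<nu> F"
proof -
  define C where "C = {f. continuous_map X euclideanreal f}"
  define I where "I M = (\<lambda>f\<in>C. LINT x|M. f x)" for M
  have lim: "limitin (product_topology (\<lambda>_. euclideanreal) C) (I \<circ> \<mu>) (I \<nu>) F"
    unfolding limitin_componentwise using assms(3) by (auto simp: I_def C_def)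
  show ?thesis
    unfolding limitin_def
  proof (intro conjI allI impI)
    show "\<nu> \<in> topspace (prob_topology X)" using assms(2) by (simp add: topspace_prob_topology)
    fix U assume "openin (prob_topology X) U \<and> \<nu> \<in> U"
    then obtain V where V: "openin (product_topology (\<lambda>_. euclideanreal) C) V"
      "U = I -` V \<inter> borel_probabilities X" "\<nu> \<in> U"
      unfolding prob_topology_def openin_pullback_topology I_def C_def by auto
    then have "\<forall>\<^sub>F r in F. (I \<circ> \<mu>) r \<in> V" using lim by (auto simp: limitin_def)
    then show "\<forall>\<^sub>F r in F. \<mu> r \<in> U" by eventually_elim (simp add: V assms(1))
  qed
qed

text \<open>A neighbourhood of a map in the product topology constrains only finitely many measures. For those,
  almost everywhere convergence of the powers along one sequence yields weak convergence of the
  push-forwards by dominated convergence. The map \<open>g \<mu>\<close> may depend on \<open>\<mu>\<close>, and the sequence on the finite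
  set.\<close>
lemma in_enveloping_semigroup_of_measures:
  assumes g: "\<And>\<mu>. \<mu> \<in> borel_probabilities hull_space \<Longrightarrow> g \<mu> \<in> borel_of hull_space \<rightarrow>\<^sub>M borel_of hull_space"
    and lim: "\<And>M. finite M \<Longrightarrow> M \<subseteq> borel_probabilities hull_space \<Longrightarrow>
      \<exists>i::nat \<Rightarrow> nat. \<forall>\<mu>\<in>M. AE x in \<mu>. (\<lambda>r. act (hole (i r)) x) \<longlonglongrightarrow> g \<mu> x"
  shows "(\<lambda>\<mu>\<in>borel_probabilities hull_space. distr \<mu> (borel_of hull_space) (g \<mu>))
    \<in> enveloping_semigroup (prob_topology hull_space) (prob_map hull_space (act 1))"
proof -
  let ?B = "borel_probabilities hull_space" and ?Pr = "prob_topology hull_space"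
  let ?T = "prob_map hull_space (act 1)"
  let ?P = "\<lambda>\<mu>\<in>?B. distr \<mu> (borel_of hull_space) (g \<mu>)"
  note meas = measurable_borel_probability
  have distr: "distr \<mu> (borel_of hull_space) h \<in> ?B" if "\<mu> \<in> ?B" "h \<in> borel_of hull_space \<rightarrow>\<^sub>M borel_of hull_space" for \<mu> h
    using meas[OF that] borel_probabilitiesD(1)[OF that(1)] by (intro distr_in_borel_probabilities)
  have conv: "limitin ?Pr (\<lambda>r. distr \<mu> (borel_of hull_space) (act (hole (i r)))) (?P \<mu>) sequentially"
    if \<mu>: "\<mu> \<in> ?B" and i: "AE x in \<mu>. (\<lambda>r::nat. act (hole (i r)) x) \<longlonglongrightarrow> g \<mu> x" for \<mu> i
  proof (rule limitin_prob_topology)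
    show "distr \<mu> (borel_of hull_space) (act (hole (i r))) \<in> ?B" for r
      by (rule distr[OF \<mu> measurable_act])
    show "?P \<mu> \<in> ?B" using distr[OF \<mu> g[OF \<mu>]] \<mu> by simp
    fix f :: "(int \<Rightarrow> real) \<Rightarrow> real" assume "continuous_map hull_space euclideanreal f"
    then have f: "continuous_on orbit_hull f" by simp
    have fm: "f \<in> borel_measurable (borel_of hull_space)" by (rule measurable_from_X[OF f])
    have "bounded (f ` orbit_hull)"
      using compact_continuous_image[OF f compact_hull] by (rule compact_imp_bounded)
    then obtain B where B: "\<And>x. x \<in> orbit_hull \<Longrightarrow> norm (f x) \<le> B" by (auto simp: bounded_iff)
    interpret prob_space \<mu> using borel_probabilitiesD[OF \<mu>] by simp
    have sp: "space \<mu> = orbit_hull" using borel_probabilitiesD[OF \<mu>] by simp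
    have g_hull: "g \<mu> x \<in> orbit_hull" if "x \<in> orbit_hull" for x
      using measurable_space[OF g[OF \<mu>]] that by (simp add: space_borel_of)
    have "(\<lambda>r. LINT x|\<mu>. f (act (hole (i r)) x)) \<longlonglongrightarrow> (LINT x|\<mu>. f (g \<mu> x))"
    proof (rule integral_dominated_convergence[where w = "\<lambda>_. B"])
      show "(\<lambda>x. f (g \<mu> x)) \<in> borel_measurable \<mu>"
        by (rule measurable_compose[OF meas[OF \<mu> g[OF \<mu>]] fm])
      show "(\<lambda>x. f (act (hole (i r)) x)) \<in> borel_measurable \<mu>" for r
        by (rule measurable_compose[OF meas[OF \<mu> measurable_act] fm])
      show "AE x in \<mu>. norm (f (act (hole (i r)) x)) \<le> B" for r
        using B act_in_hull by (intro AE_I2) (auto simp: sp)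
      show "AE x in \<mu>. (\<lambda>r. f (act (hole (i r)) x)) \<longlonglongrightarrow> f (g \<mu> x)"
        using i AE_space
      proof eventually_elim
        case (elim x)
        show ?case
          by (rule continuous_on_tendsto_compose[OF f elim(1)])
            (use elim(2) in \<open>simp_all add: sp act_in_hull g_hull\<close>)
      qed
    qed simp
    then show "(\<lambda>r. LINT x|distr \<mu> (borel_of hull_space) (act (hole (i r))). f x) \<longlonglongrightarrow> (LINT x|?P \<mu>. f x)"
      using \<mu> by (simp add: integral_distr[OF meas[OF \<mu> measurable_act] fm] integral_distr[OF meas[OF \<mu> g[OF \<mu>]] fm])
  qed
  show ?thesis
    unfolding enveloping_semigroup_def in_closure_of topspace_prob_topology
  proof (intro conjI allI impI)
    show "?P \<in> topspace (product_topology (\<lambda>_. ?Pr) ?B)"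
      using distr g by (auto simp: topspace_prob_topology)
    fix V assume V: "?P \<in> V \<and> openin (product_topology (\<lambda>_. ?Pr) ?B) V"
    then have "\<exists>U. finite {\<mu> \<in> ?B. U \<mu> \<noteq> topspace ?Pr} \<and> (\<forall>\<mu>\<in>?B. openin ?Pr (U \<mu>)) \<and>
        ?P \<in> PiE ?B U \<and> PiE ?B U \<subseteq> V"
      by (simp only: openin_product_topology_alt)
    then obtain U where *: "finite {\<mu> \<in> ?B. U \<mu> \<noteq> topspace ?Pr} \<and> (\<forall>\<mu>\<in>?B. openin ?Pr (U \<mu>)) \<and>
        ?P \<in> PiE ?B U \<and> PiE ?B U \<subseteq> V" by (rule exE)
    note U = *[THEN conjunct1] *[THEN conjunct2, THEN conjunct1, rule_format]
      *[THEN conjunct2, THEN conjunct2, THEN conjunct1] *[THEN conjunct2, THEN conjunct2, THEN conjunct2]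
    define M where "M = {\<mu> \<in> ?B. U \<mu> \<noteq> topspace ?Pr}"
    obtain i :: "nat \<Rightarrow> nat" where i: "\<And>\<mu>. \<mu> \<in> M \<Longrightarrow> AE x in \<mu>. (\<lambda>r. act (hole (i r)) x) \<longlonglongrightarrow> g \<mu> x"
    proof -
      have "finite M" "M \<subseteq> ?B" using U(1) by (auto simp: M_def)
      from lim[OF this] show ?thesis using that by blast
    qed
    have "\<forall>\<^sub>F r in sequentially. \<forall>\<mu>\<in>M. distr \<mu> (borel_of hull_space) (act (hole (i r))) \<in> U \<mu>"
    proof (rule eventually_ball_finite)
      show "finite M" using U(1) by (simp add: M_def)
      show "\<forall>\<mu>\<in>M. \<forall>\<^sub>F r in sequentially. distr \<mu> (borel_of hull_space) (act (hole (i r))) \<in> U \<mu>"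
      proof
        fix \<mu> assume "\<mu> \<in> M"
        then have \<mu>: "\<mu> \<in> ?B" by (simp add: M_def)
        then have "?P \<mu> \<in> U \<mu>" using U(3) by (rule PiE_mem[rotated])
        then show "\<forall>\<^sub>F r in sequentially. distr \<mu> (borel_of hull_space) (act (hole (i r))) \<in> U \<mu>"
          using conv[OF \<mu> i[OF \<open>\<mu> \<in> M\<close>]] U(2)[OF \<mu>] by (simp add: limitin_def)
      qed
    qed
    then obtain r where r: "\<And>\<mu>. \<mu> \<in> M \<Longrightarrow> distr \<mu> (borel_of hull_space) (act (hole (i r))) \<in> U \<mu>"
      by (auto simp: eventually_sequentially)
    have it: "int_iterate ?Pr ?T (hole (i r)) \<mu> = distr \<mu> (borel_of hull_space) (act (hole (i r)))" if "\<mu> \<in> ?B" for \<mu>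
      using prob_map_funpow[OF that, of "nat (hole (i r))"] hole_nonneg[of "i r"] by (simp add: int_iterate_def)
    have "int_iterate ?Pr ?T (hole (i r)) \<mu> \<in> U \<mu>" if \<mu>: "\<mu> \<in> ?B" for \<mu>
        using r[of \<mu>] distr[OF \<mu> measurable_act] \<mu> unfolding it[OF \<mu>]
        by (cases "\<mu> \<in> M") (auto simp: M_def topspace_prob_topology)
    then have "restrict (int_iterate ?Pr ?T (hole (i r))) ?B \<in> PiE ?B U"
      by (simp add: restrict_PiE_iff)
    then show "\<exists>y. y \<in> range (\<lambda>n. restrict (int_iterate ?Pr ?T n) ?B) \<and> y \<in> V"
      using U(4) by blast
  qed
qed

section \<open>Two elements with the same restriction\<close>

lemma tendsto_limit_pt_one:
  assumes "x \<in> orbit_hull" shows "(\<lambda>r. act (hole (one_ix r)) x) \<longlonglongrightarrow> limit_pt 1 x"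
  by (rule tendsto_limit_pt[OF assms]) (simp_all add: phi_one_ix filterlim_one_ix)

lemma tendsto_limit_pt_zero:
  assumes "x \<in> orbit_hull" shows "(\<lambda>r. act (hole (zero_ix r)) x) \<longlonglongrightarrow> limit_pt 0 x"
  by (rule tendsto_limit_pt[OF assms]) (simp_all add: phi_zero_ix filterlim_zero_ix)

lemma limit_pt_in_hull:
  assumes "x \<in> orbit_hull" shows "limit_pt 1 x \<in> orbit_hull" "limit_pt 0 x \<in> orbit_hull"
  using hull_limit[OF tendsto_limit_pt_one[OF assms]] hull_limit[OF tendsto_limit_pt_zero[OF assms]]
    act_in_hull[OF assms] by blast+

lemma measurable_limit_pt:
  "limit_pt 1 \<in> borel_of hull_space \<rightarrow>\<^sub>M borel_of hull_space" "limit_pt 0 \<in> borel_of hull_space \<rightarrow>\<^sub>M borel_of hull_space"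
proof -
  have "limit_pt 1 \<in> borel_measurable (borel_of hull_space)"
    by (rule borel_measurable_LIMSEQ_metric[where f = "\<lambda>r. act (hole (one_ix r))"])
      (simp_all add: measurable_from_X continuous_act space_borel_of tendsto_limit_pt_one)
  moreover have "limit_pt 0 \<in> borel_measurable (borel_of hull_space)"
    by (rule borel_measurable_LIMSEQ_metric[where f = "\<lambda>r. act (hole (zero_ix r))"])
      (simp_all add: measurable_from_X continuous_act space_borel_of tendsto_limit_pt_zero)
  ultimately show "limit_pt 1 \<in> borel_of hull_space \<rightarrow>\<^sub>M borel_of hull_space" "limit_pt 0 \<in> borel_of hull_space \<rightarrow>\<^sub>M borel_of hull_space"
    by (auto intro!: measurable_into_X simp: space_borel_of limit_pt_in_hull)
qed

text \<open>Atoms follow the bumps at height 1, and everything else drops to height 0.\<close>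
definition atom_limit :: "(int \<Rightarrow> real) measure \<Rightarrow> (int \<Rightarrow> real) \<Rightarrow> int \<Rightarrow> real" where
  "atom_limit \<mu> x = (if measure \<mu> {x} = 0 then limit_pt 0 x else limit_pt 1 x)"

lemma countable_in_sets:
  assumes "countable A" "A \<subseteq> orbit_hull" shows "A \<in> sets (borel_of hull_space)"
  using assms by (intro sets.countable[OF _ assms(1)] singleton_in_sets) auto

lemma countable_atoms:
  assumes "\<mu> \<in> borel_probabilities X" shows "countable {x. measure \<mu> {x} \<noteq> 0}"
proof -
  interpret prob_space \<mu> by (rule borel_probabilitiesD[OF assms])
  show ?thesis by (rule countable_support)
qed

lemma measurable_atom_limit:
  assumes "\<mu> \<in> borel_probabilities hull_space"
  shows "atom_limit \<mu> \<in> borel_of hull_space \<rightarrow>\<^sub>M borel_of hull_space"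
proof -
  have "{x \<in> orbit_hull. measure \<mu> {x} \<noteq> 0} \<in> sets (borel_of hull_space)"
    using countable_atoms[OF assms] by (intro countable_in_sets) (auto intro: countable_subset)
  from sets.compl_sets[OF this] have "{x \<in> space (borel_of hull_space). measure \<mu> {x} = 0} \<in> sets (borel_of hull_space)"
    by (rule back_subst[where P = "\<lambda>A. A \<in> sets (borel_of hull_space)"]) (auto simp: space_borel_of)
  then show ?thesis unfolding atom_limit_def
    by (intro measurable_If measurable_limit_pt)
qed

text \<open>The bumps have to sit on the parameters of all atoms of the given measures. A point whose parameter is
  among these countably many, but which is not itself an atom of \<open>\<mu>\<close>, belongs to a countable set of points
  of mass 0.\<close>
lemma AE_atom_limit:
  assumes M: "finite M" "M \<subseteq> borel_probabilities hull_space"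
  shows "\<exists>i::nat \<Rightarrow> nat. \<forall>\<mu>\<in>M. AE x in \<mu>. (\<lambda>r. act (hole (i r)) x) \<longlonglongrightarrow> atom_limit \<mu> x"
proof -
  \<comment> \<open>On the fibre with the holes at \<open>hole i + j\<close>, \<open>coord j\<close> is the parameter.\<close>
  define coord :: "int \<Rightarrow> (int \<Rightarrow> real) \<Rightarrow> real" where "coord j x = x (2 * (hole id_ix + j))" for j x
  have coord_fibre_point: "coord j (act (- j) (fibre_point \<kappa>)) = \<kappa>" if "0 \<le> \<kappa>" "\<kappa> \<le> 1" for j \<kappa>
    using that unfolding coord_def act_fibre_point_hole by (rule phi_id_ix)
  define At where "At = (\<Union>\<mu>\<in>M. {x. measure \<mu> {x} \<noteq> 0})"
  have "countable At" unfolding At_def using M countable_atoms by (intro countable_UN) (auto intro: countable_finite)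
  \<comment> \<open>The element 0 only makes \<open>S\<close> nonempty.\<close>
  define S where "S = insert 0 (\<Union>j. coord j ` At)"
  have "S \<noteq> {}" by (simp add: S_def)
  have "countable S" unfolding S_def using \<open>countable At\<close> by auto
  define N where "N = (\<Union>\<mu>\<in>M. range (\<lambda>j. distr \<mu> borel (coord j)))"
  have coord_meas: "coord j \<in> borel_measurable \<mu>" if "\<mu> \<in> M" for j \<mu>
    unfolding coord_def using that M(2)
    by (intro measurable_borel_probability[OF _ measurable_from_X] continuous_on_subset[OF continuous_on_product_coordinates]) auto
  have N1: "countable N" unfolding N_def using M(1) by (intro countable_UN) (auto intro: countable_finite)
  have N2: "finite_measure \<nu>" if \<nu>: "\<nu> \<in> N" for \<nu>
  proof -
    obtain \<mu> j where \<mu>: "\<mu> \<in> M" "\<nu> = distr \<mu> borel (coord j)" using \<nu> by (auto simp: N_def)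
    interpret prob_space \<mu> using \<mu> M(2) borel_probabilitiesD by blast
    show ?thesis unfolding \<mu>(2) by (rule finite_measure_distr[OF coord_meas[OF \<mu>(1)]])
  qed
  have N3: "sets \<nu> = sets borel" if "\<nu> \<in> N" for \<nu> using that by (auto simp: N_def)
  obtain i where i: "filterlim i at_top sequentially"
    "\<And>\<kappa>. \<kappa> \<in> S \<Longrightarrow> (\<lambda>r. phi (i r) \<kappa>) \<longlonglongrightarrow> 1"
    "\<And>\<nu>. \<nu> \<in> N \<Longrightarrow> AE \<kappa> in \<nu>. \<kappa> \<notin> S \<longrightarrow> (\<lambda>r. phi (i r) \<kappa>) \<longlonglongrightarrow> 0"
    by (rule separating_bumps[OF N1 N2 N3 \<open>countable S\<close> \<open>S \<noteq> {}\<close>]) blast+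
  have "AE x in \<mu>. (\<lambda>r. act (hole (i r)) x) \<longlonglongrightarrow> atom_limit \<mu> x" if \<mu>: "\<mu> \<in> M" for \<mu>
  proof -
    have \<mu>B: "\<mu> \<in> borel_probabilities hull_space" using \<mu> M(2) by auto
    interpret prob_space \<mu> by (rule borel_probabilitiesD[OF \<mu>B])
    have sp: "space \<mu> = orbit_hull" and st: "sets \<mu> = sets (borel_of hull_space)"
      using borel_probabilitiesD[OF \<mu>B] by auto
    define C where "C = {x \<in> orbit_hull. measure \<mu> {x} = 0 \<and> (\<exists>j. \<exists>\<kappa>\<in>S. x = act (- j) (fibre_point \<kappa>))}"
    have "C \<subseteq> (\<Union>j. (\<lambda>\<kappa>. act (- j) (fibre_point \<kappa>)) ` S)" by (auto simp: C_def)
    then have "countable C" by (rule countable_subset) (use \<open>countable S\<close> in auto)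
    then have 1: "AE x in \<mu>. x \<notin> C"
      by (rule AE_discrete_difference) (auto simp: C_def emeasure_eq_measure st singleton_in_sets)
    have "AE x in \<mu>. coord j x \<notin> S \<longrightarrow> (\<lambda>r. phi (i r) (coord j x)) \<longlonglongrightarrow> 0" for j
      using i(3)[of "distr \<mu> borel (coord j)"] \<mu> by (intro AE_distrD[OF coord_meas[OF \<mu>]]) (auto simp: N_def)
    then have 2: "AE x in \<mu>. \<forall>j. coord j x \<notin> S \<longrightarrow> (\<lambda>r. phi (i r) (coord j x)) \<longlonglongrightarrow> 0"
      by (simp add: AE_all_countable)
    from 1 2 AE_space show ?thesis
    proof eventually_elim
      case (elim x)
      then have x: "x \<in> orbit_hull" by (simp add: sp)
      show ?case
      proof (cases "measure \<mu> {x} = 0")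
        case True
        have "(\<lambda>r. act (hole (i r)) x) \<longlonglongrightarrow> limit_pt 0 x"
        proof (rule tendsto_limit_pt[OF x i(1)])
          fix j \<kappa> assume \<kappa>: "0 \<le> \<kappa>" "\<kappa> \<le> 1" "x = act (- j) (fibre_point \<kappa>)"
          then have c: "coord j x = \<kappa>" using coord_fibre_point by simp
          have "\<kappa> \<notin> S" using elim(1) x True \<kappa>(3) by (auto simp: C_def)
          then show "(\<lambda>r. phi (i r) \<kappa>) \<longlonglongrightarrow> 0" using elim(2)[rule_format, of j] c by simp
        qed
        then show ?thesis using True by (simp add: atom_limit_def)
      next
        case False
        then have "x \<in> At" using \<mu> by (auto simp: At_def)
        have "(\<lambda>r. act (hole (i r)) x) \<longlonglongrightarrow> limit_pt 1 x"
        proof (rule tendsto_limit_pt[OF x i(1)])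
          fix j \<kappa> assume \<kappa>: "0 \<le> \<kappa>" "\<kappa> \<le> 1" "x = act (- j) (fibre_point \<kappa>)"
          then have "coord j x = \<kappa>" using coord_fibre_point by simp
          then have "\<kappa> \<in> S" using \<open>x \<in> At\<close> by (auto simp: S_def)
          then show "(\<lambda>r. phi (i r) \<kappa>) \<longlonglongrightarrow> 1" by (rule i(2))
        qed
        then show ?thesis using False by (simp add: atom_limit_def)
      qed
    qed
  qed
  then show ?thesis by blast
qed

definition env_one :: "(int \<Rightarrow> real) measure \<Rightarrow> (int \<Rightarrow> real) measure" where
  "env_one = (\<lambda>\<mu>\<in>borel_probabilities hull_space. distr \<mu> (borel_of hull_space) (limit_pt 1))"

definition env_atom :: "(int \<Rightarrow> real) measure \<Rightarrow> (int \<Rightarrow> real) measure" where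
  "env_atom = (\<lambda>\<mu>\<in>borel_probabilities hull_space. distr \<mu> (borel_of hull_space) (atom_limit \<mu>))"

lemma env_atom_in: "env_atom \<in> enveloping_semigroup (prob_topology hull_space) (prob_map hull_space (act 1))"
  unfolding env_atom_def
  by (rule in_enveloping_semigroup_of_measures[OF measurable_atom_limit AE_atom_limit])

lemma env_one_in: "env_one \<in> enveloping_semigroup (prob_topology hull_space) (prob_map hull_space (act 1))"
  unfolding env_one_def
proof (rule in_enveloping_semigroup_of_measures)
  fix M assume "M \<subseteq> borel_probabilities hull_space"
  then have "AE x in \<mu>. (\<lambda>r. act (hole (one_ix r)) x) \<longlonglongrightarrow> limit_pt 1 x" if "\<mu> \<in> M" for \<mu>
    using borel_probabilitiesD(3)[of \<mu> hull_space] that by (intro AE_I2 tendsto_limit_pt_one) auto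
  then show "\<exists>i::nat \<Rightarrow> nat. \<forall>\<mu>\<in>M. AE x in \<mu>. (\<lambda>r. act (hole (i r)) x) \<longlonglongrightarrow> limit_pt 1 x" by blast
qed (rule measurable_limit_pt)

lemma env_dirac:
  assumes x: "x \<in> orbit_hull"
  shows "env_atom (dirac hull_space x) = env_one (dirac hull_space x)"
proof -
  let ?d = "dirac hull_space x"
  have d: "?d \<in> borel_probabilities hull_space"
    using x by (auto simp: dirac_def borel_probabilities_def space_borel_of intro: prob_space_return)
  have "measure ?d {x} = 1"
    using singleton_in_sets[OF x] by (simp add: dirac_def measure_return)
  then have "atom_limit ?d x = limit_pt 1 x" by (simp add: atom_limit_def)
  moreover have "distr ?d (borel_of hull_space) f = return (borel_of hull_space) (f x)"
    if "f \<in> borel_of hull_space \<rightarrow>\<^sub>M borel_of hull_space" for f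
    unfolding dirac_def using x by (intro distr_return that) (simp add: space_borel_of)
  ultimately show ?thesis
    using d measurable_atom_limit[OF d] measurable_limit_pt by (simp add: env_atom_def env_one_def)
qed

lemma continuous_fibre_point: "continuous_on A fibre_point"
proof (rule continuous_on_coordinatewise_then_product)
  fix k show "continuous_on A (\<lambda>\<kappa>. fibre_point \<kappa> k)"
    by (cases "even k"; cases "k div 2 \<in> range hole") (simp_all add: fibre_point_def continuous_phi)
qed

text \<open>The image of Lebesgue measure on the fibre has no atoms, since the parameter of a point can be read off
  from its symbols. Hence \<open>env_atom\<close> moves it to points with symbol 0 at the origin, and \<open>env_one\<close> moves it to points
  with symbol 1 there.\<close>
lemma env_atom_neq_env_one: "env_atom \<noteq> env_one"
proof
  assume eq: "env_atom = env_one"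
  define U where "U = restrict_space lborel {0<..<1::real}"
  interpret U: prob_space U unfolding U_def by (rule prob_space_restrict_space) auto
  have spU: "space U = {0<..<1}" by (simp add: U_def space_restrict_space)
  have fibre_point: "fibre_point \<in> U \<rightarrow>\<^sub>M borel_of hull_space"
  proof (rule measurable_into_X)
    have "fibre_point \<in> borel_measurable lborel"
      using borel_measurable_continuous_onI[OF continuous_fibre_point] by simp
    then show "fibre_point \<in> borel_measurable U" unfolding U_def by (rule measurable_restrict_space1)
    show "fibre_point \<kappa> \<in> orbit_hull" if "\<kappa> \<in> space U" for \<kappa> using that by (simp add: spU fibre_point_in_hull)
  qed
  define \<mu> where "\<mu> = distr U (borel_of hull_space) fibre_point"
  have \<mu>: "\<mu> \<in> borel_probabilities hull_space"
    unfolding \<mu>_def by (rule distr_in_borel_probabilities[OF U.prob_space_axioms fibre_point])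
  have null: "measure \<mu> {x} = 0" if x: "x \<in> orbit_hull" for x
  proof -
    have "fibre_point -` {x} \<inter> space U \<subseteq> {x (2 * hole id_ix)}"
      by (auto simp: spU fibre_point_hole phi_id_ix)
    then have "fibre_point -` {x} \<inter> space U \<in> null_sets lborel"
      by (intro countable_imp_null_set_lborel) (rule countable_subset, auto)
    then have "emeasure U (fibre_point -` {x} \<inter> space U) = 0"
      unfolding U_def by (subst emeasure_restrict_space) (auto simp: space_restrict_space)
    then show ?thesis
      unfolding \<mu>_def using singleton_in_sets[OF x] by (simp only: measure_distr[OF fibre_point]) (simp add: measure_def)
  qed
  have "distr \<mu> (borel_of hull_space) (atom_limit \<mu>) = distr \<mu> (borel_of hull_space) (limit_pt 0)"
    using borel_probabilitiesD(3)[OF \<mu>] by (intro distr_cong) (auto simp: atom_limit_def null)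
  then have eq': "distr \<mu> (borel_of hull_space) (limit_pt 0) = distr \<mu> (borel_of hull_space) (limit_pt 1)"
    using \<mu> fun_cong[OF eq, of \<mu>] by (simp add: env_atom_def env_one_def)
  define E where "E = {x \<in> orbit_hull. x 0 = 1}"
  have E: "E \<in> sets (borel_of hull_space)"
  proof -
    have "(\<lambda>x. x 0) \<in> borel_measurable (borel_of hull_space)"
      by (rule measurable_from_X) (rule continuous_on_subset[OF continuous_on_product_coordinates], simp)
    then have "(\<lambda>x. x 0) -` {1} \<inter> space (borel_of hull_space) \<in> sets (borel_of hull_space)"
      by (rule measurable_sets) simp
    then show ?thesis by (rule back_subst[where P = "\<lambda>A. A \<in> sets (borel_of hull_space)"]) (auto simp: space_borel_of E_def)
  qed
  have val: "measure (distr \<mu> (borel_of hull_space) (limit_pt c)) E = measure U {\<kappa> \<in> space U. limit_pt c (fibre_point \<kappa>) \<in> E}"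
    if c: "limit_pt c \<in> borel_of hull_space \<rightarrow>\<^sub>M borel_of hull_space" for c
  proof -
    have "distr \<mu> (borel_of hull_space) (limit_pt c) = distr U (borel_of hull_space) (limit_pt c \<circ> fibre_point)"
      unfolding \<mu>_def by (rule distr_distr[OF c fibre_point])
    then show ?thesis
      using measure_distr[OF measurable_comp[OF fibre_point c] E] by (simp add: vimage_def Int_def conj_commute)
  qed
  have empty: "{\<kappa> \<in> space U. limit_pt 0 (fibre_point \<kappa>) \<in> E} = {}" by (auto simp: spU E_def limit_pt_fibre_point)
  have full: "{\<kappa> \<in> space U. limit_pt 1 (fibre_point \<kappa>) \<in> E} = space U"
    by (auto simp: spU E_def limit_pt_fibre_point limit_pt_in_hull fibre_point_in_hull)
  show False
    using val[OF measurable_limit_pt(1)] val[OF measurable_limit_pt(2)] eq' U.prob_space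
    unfolding empty full by simp
qed

lemma not_injective_orbit_hull: "\<not> injective_system hull_space (act 1)"
proof
  assume "injective_system hull_space (act 1)"
  moreover have "enveloping_restriction hull_space env_atom = enveloping_restriction hull_space env_one"
    by (auto simp: enveloping_restriction_def env_dirac)
  ultimately have "env_atom = env_one"
    unfolding injective_system_def using env_atom_in env_one_in by (metis inj_onD)
  then show False using env_atom_neq_env_one by blast
qed

theorem theorem5p7:
  shows "\<exists>(X :: (int \<Rightarrow> real) topology) T. toeplitz_system X T \<and> \<not> injective_system X T"
  using toeplitz_orbit_hull not_injective_orbit_hull by blast

end
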